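(* Let $\mathfrak g^{\mathbb C}$ be a complex simple Lie algebra with $\mathfrak g^{\mathbb C}\not\cong\mathfrak{sl}(2,\mathbb C)$, and equip the minimal nilpotent orbit $\mathcal O_{\mathrm{min}}\subset\mathfrak g^{\mathbb C}$ with its unique hyperKähler metric with $G$-invariant Kähler potential (for the complex structure $I$) compatible with the complex symplectic form $\omega_c$. Then the complex structure $J$ of this hyperKähler structure is given, for $X\in\mathcal O_{\mathrm{min}}$ and $A\in\mathfrak g^{\mathbb C}$, by $$J_X\xi_A=-\frac{\lambda}{2\eta^{3/2}}\Bigl(2\eta\,[X,\sigma\xi_A]-\langle\sigma\xi_A,X\rangle\,[X,\sigma X]\Bigr),$$ where $\eta=\eta(X)=\langle X,\sigma X\rangle$ and $\lambda>0$ is the constant with $\lambda^2=\eta(E_\alpha)$, $\alpha$ a highest root.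
   Context: Let $\langle\cdot,\cdot\rangle$ be the negative of the (complex bilinear) Killing form of $\mathfrak g^{\mathbb C}$, let $\sigma$ be a real structure on $\mathfrak g^{\mathbb C}$ giving a compact real form $\mathfrak g$, let $G$ be the compact simple simply-connected Lie group with Lie algebra $\mathfrak g$, and $G^{\mathbb C}$ its complexification, acting on $\mathfrak g^{\mathbb C}$ by the adjoint action. Fix a Cartan subalgebra, a root system $\Delta$ with positive roots $\Delta_+$, and a Cartan basis $\{E_\beta,H_\beta,F_\beta:\beta\in\Delta_+\}$ of $\mathfrak g^{\mathbb C}$, where each triple $E_\beta,H_\beta,F_\beta$ satisfies the standard $\mathfrak{sl}(2,\mathbb C)$ relations $[H_\beta,E_\beta]=2E_\beta$, $[H_\beta,F_\beta]=-2F_\beta$, $[E_\beta,F_\beta]=H_\beta$, compatible with $\sigma$ in the sense that $\sigma(E_\beta)=-F_\beta$, $\sigma(H_\beta)=-H_\beta$. A root $\alpha\in\Delta_+$ is a highest root if $[E_\alpha,E_\beta]=0$ for all $\beta\in\Delta_+$. The minimal nilpotent orbit $\mathcal O_{\mathrm{min}}$ is the $G^{\mathbb C}$-adjoint orbit of $E_\alpha$, for $\alpha$ a highest root. At a point $X$ of the orbit the tangent vectors are $\xi_A=[A,X]$, $A\in\mathfrak g^{\mathbb C}$. The orbit is a complex submanifold of $\mathfrak g^{\mathbb C}$ with complex structure $I\xi_A=i\xi_A=\xi_{iA}$. The Kirillov-Kostant-Souriau complex symplectic form is $\omega_c(\xi_A,\xi_B)_X=\langle X,[A,B]\rangle$.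 A hyperKähler metric on a manifold is a Riemannian metric $g$ together with complex structures $I,J,K$ satisfying $IJ=K=-JI$, such that $g$ is Kähler with respect to each of them; the Kähler forms are $\omega_I(Y,Z)=g(Y,IZ)$, $\omega_J(Y,Z)=g(Y,JZ)$, $\omega_K(Y,Z)=g(Y,KZ)$ for tangent vectors $Y,Z$. Here $I$ is always the natural complex structure of the orbit given by $I\xi_A=i\xi_A=\xi_{iA}$ for $A\in\mathfrak g^{\mathbb C}$. The metric is compatible with $\omega_c$ if $\omega_c=\omega_J+i\omega_K$. A smooth real function $\rho$ on the orbit is a Kähler potential for $I$ if $\omega_I=-i\,\partial_I\overline{\partial_I}\rho=-\tfrac12\,d\,I\,d\rho$, where for a one-form $\theta$ one puts $(I\theta)(Y)=-\theta(IY)$. For $\mathfrak g^{\mathbb C}\not\cong\mathfrak{sl}(2,\mathbb C)$ there is exactly one hyperKähler metric on $\mathcal O_{\mathrm{min}}$ with $G$-invariant Kähler potential for $I$ and compatible with $\omega_c$. *)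

theory Defs
  imports "HOL-Analysis.Analysis"
begin

section \<open>Complex Lie algebras\<close>

text \<open>
  A finite-dimensional complex Lie algebra is modelled, after a choice of vector space basis, as a
  bracket on \<open>complex ^ 'n\<close>. Complex scalar multiplication is \<open>*s\<close>, and the complex subspaces and
  complex spans are \<^const>\<open>vec.subspace\<close> and \<^const>\<open>vec.span\<close>.
\<close>

type_synonym 'n bracket = "complex ^ 'n \<Rightarrow> complex ^ 'n \<Rightarrow> complex ^ 'n"

definition lie_algebra :: "('n::finite) bracket \<Rightarrow> bool" where
  "lie_algebra br \<longleftrightarrow>
     (\<forall>A. Vector_Spaces.linear (*s) (*s) (\<lambda>B. br A B)) \<and>
     (\<forall>B. Vector_Spaces.linear (*s) (*s) (\<lambda>A. br A B)) \<and>
     (\<forall>A. br A A = 0) \<and>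
     (\<forall>A B C. br A (br B C) + br B (br C A) + br C (br A B) = 0)"

definition simple_lie_algebra :: "('n::finite) bracket \<Rightarrow> bool" where
  "simple_lie_algebra br \<longleftrightarrow>
     lie_algebra br \<and>
     (\<exists>A B. br A B \<noteq> 0) \<and>
     (\<forall>S. vec.subspace S \<and> (\<forall>A. \<forall>B\<in>S. br A B \<in> S) \<longrightarrow> S = {0} \<or> S = UNIV)"

text \<open>On \<open>complex ^ 2 ^ 2\<close> the complex multiple of \<open>M\<close> by \<open>c\<close> is \<open>mat c ** M\<close>.\<close>

definition isomorphic_sl2 :: "('n::finite) bracket \<Rightarrow> bool" where
  "isomorphic_sl2 br \<longleftrightarrow>
     (\<exists>\<phi> :: complex ^ 'n \<Rightarrow> complex ^ 2 ^ 2.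
        (\<forall>A B. \<phi> (A + B) = \<phi> A + \<phi> B) \<and>
        (\<forall>c A. \<phi> (c *s A) = mat c ** \<phi> A) \<and>
        bij_betw \<phi> UNIV {M. trace M = 0} \<and>
        (\<forall>A B. \<phi> (br A B) = \<phi> A ** \<phi> B - \<phi> B ** \<phi> A))"

definition killing :: "('n::finite) bracket \<Rightarrow> complex ^ 'n \<Rightarrow> complex ^ 'n \<Rightarrow> complex" where
  "killing br A B = trace (matrix (\<lambda>C. br A (br B C)))"

definition ip :: "('n::finite) bracket \<Rightarrow> complex ^ 'n \<Rightarrow> complex ^ 'n \<Rightarrow> complex" where
  "ip br A B = - killing br A B"

text \<open>
  The real form \<open>{A. \<sigma> A = A}\<close> is compact when its Killing form is negative definite. Its Killing form
  is the restriction of the complex one, which takes real values there.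
\<close>

definition compact_real_structure ::
    "('n::finite) bracket \<Rightarrow> (complex ^ 'n \<Rightarrow> complex ^ 'n) \<Rightarrow> bool" where
  "compact_real_structure br \<sigma> \<longleftrightarrow>
     (\<forall>A B. \<sigma> (A + B) = \<sigma> A + \<sigma> B) \<and>
     (\<forall>c A. \<sigma> (c *s A) = cnj c *s \<sigma> A) \<and>
     (\<forall>A. \<sigma> (\<sigma> A) = A) \<and>
     (\<forall>A B. \<sigma> (br A B) = br (\<sigma> A) (\<sigma> B)) \<and>
     (\<forall>A. \<sigma> A = A \<and> A \<noteq> 0 \<longrightarrow> Re (killing br A A) < 0)"

text \<open>\<open>ip br X (\<sigma> X)\<close> is real (and nonnegative) for a compact real structure, so taking the real part
  only changes the type.\<close>

definition eta :: "('n::finite) bracket \<Rightarrow> (complex ^ 'n \<Rightarrow> complex ^ 'n) \<Rightarrow> complex ^ 'n \<Rightarrow> real" where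
  "eta br \<sigma> X = Re (ip br X (\<sigma> X))"

section \<open>Cartan subalgebras, roots and Cartan bases\<close>

primrec lower_central :: "('n::finite) bracket \<Rightarrow> (complex ^ 'n) set \<Rightarrow> nat \<Rightarrow> (complex ^ 'n) set" where
  "lower_central br h 0 = h"
| "lower_central br h (Suc k) = vec.span {br x y |x y. x \<in> h \<and> y \<in> lower_central br h k}"

definition cartan_subalgebra :: "('n::finite) bracket \<Rightarrow> (complex ^ 'n) set \<Rightarrow> bool" where
  "cartan_subalgebra br h \<longleftrightarrow>
     vec.subspace h \<and>
     (\<forall>x\<in>h. \<forall>y\<in>h. br x y \<in> h) \<and>
     (\<exists>k. lower_central br h k = {0}) \<and>
     {A. \<forall>x\<in>h. br A x \<in> h} = h"

definition root_space ::
    "('n::finite) bracket \<Rightarrow> (complex ^ 'n) set \<Rightarrow> (complex ^ 'n \<Rightarrow> complex) \<Rightarrow> (complex ^ 'n) set" where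
  "root_space br h \<beta> = {v. \<forall>x\<in>h. br x v = \<beta> x *s v}"

text \<open>
  A functional on \<open>h\<close> is represented by its extension by \<open>0\<close> outside \<open>h\<close>. Linearity of a root on \<open>h\<close>
  is forced by its nonzero root space.
\<close>

definition roots :: "('n::finite) bracket \<Rightarrow> (complex ^ 'n) set \<Rightarrow> (complex ^ 'n \<Rightarrow> complex) set" where
  "roots br h = {\<beta>. (\<forall>x. x \<notin> h \<longrightarrow> \<beta> x = 0) \<and> (\<exists>x\<in>h. \<beta> x \<noteq> 0) \<and> root_space br h \<beta> \<noteq> {0}}"

definition positive_system ::
    "('n::finite) bracket \<Rightarrow> (complex ^ 'n) set \<Rightarrow> (complex ^ 'n \<Rightarrow> complex) set \<Rightarrow> bool" where
  "positive_system br h P \<longleftrightarrow>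
     P \<subseteq> roots br h \<and>
     (\<forall>\<beta>\<in>roots br h. (\<beta> \<in> P) \<noteq> ((\<lambda>x. - \<beta> x) \<in> P)) \<and>
     (\<forall>\<beta>\<in>P. \<forall>\<gamma>\<in>P. (\<lambda>x. \<beta> x + \<gamma> x) \<in> roots br h \<longrightarrow> (\<lambda>x. \<beta> x + \<gamma> x) \<in> P)"

text \<open>
  In rank at least two the vectors \<open>H \<beta>\<close>, for \<open>\<beta>\<close> running over all positive roots, are linearly
  dependent, so a Cartan basis is only required to span.
\<close>

definition cartan_basis ::
    "('n::finite) bracket \<Rightarrow> (complex ^ 'n) set \<Rightarrow> (complex ^ 'n \<Rightarrow> complex) set \<Rightarrow>
     ((complex ^ 'n \<Rightarrow> complex) \<Rightarrow> complex ^ 'n) \<Rightarrow>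
     ((complex ^ 'n \<Rightarrow> complex) \<Rightarrow> complex ^ 'n) \<Rightarrow>
     ((complex ^ 'n \<Rightarrow> complex) \<Rightarrow> complex ^ 'n) \<Rightarrow> bool" where
  "cartan_basis br h P E H F \<longleftrightarrow>
     (\<forall>\<beta>\<in>P. E \<beta> \<in> root_space br h \<beta> \<and> F \<beta> \<in> root_space br h (\<lambda>x. - \<beta> x) \<and> H \<beta> \<in> h \<and>
        br (H \<beta>) (E \<beta>) = 2 *s E \<beta> \<and>
        br (H \<beta>) (F \<beta>) = - 2 *s F \<beta> \<and>
        br (E \<beta>) (F \<beta>) = H \<beta>) \<and>
     vec.span (E ` P \<union> H ` P \<union> F ` P) = UNIV"

definition sigma_compatible ::
    "(complex ^ 'n \<Rightarrow> complex ^ 'n) \<Rightarrow> (complex ^ 'n \<Rightarrow> complex) set \<Rightarrow>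
     ((complex ^ 'n \<Rightarrow> complex) \<Rightarrow> complex ^ 'n) \<Rightarrow>
     ((complex ^ 'n \<Rightarrow> complex) \<Rightarrow> complex ^ 'n) \<Rightarrow>
     ((complex ^ 'n \<Rightarrow> complex) \<Rightarrow> complex ^ 'n) \<Rightarrow> bool" where
  "sigma_compatible \<sigma> P E H F \<longleftrightarrow> (\<forall>\<beta>\<in>P. \<sigma> (E \<beta>) = - F \<beta> \<and> \<sigma> (H \<beta>) = - H \<beta>)"

definition highest_root ::
    "('n::finite) bracket \<Rightarrow> (complex ^ 'n \<Rightarrow> complex) set \<Rightarrow>
     ((complex ^ 'n \<Rightarrow> complex) \<Rightarrow> complex ^ 'n) \<Rightarrow> (complex ^ 'n \<Rightarrow> complex) \<Rightarrow> bool" where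
  "highest_root br P E \<alpha> \<longleftrightarrow> \<alpha> \<in> P \<and> (\<forall>\<beta>\<in>P. br (E \<alpha>) (E \<beta>) = 0)"

section \<open>Adjoint orbits\<close>

definition exp_ad :: "('n::finite) bracket \<Rightarrow> complex ^ 'n \<Rightarrow> complex ^ 'n \<Rightarrow> complex ^ 'n" where
  "exp_ad br A X = (\<Sum>k. (1 / fact k) *\<^sub>R ((br A) ^^ k) X)"

text \<open>
  The image under the adjoint representation of a connected Lie group with Lie algebra \<open>S\<close> is
  generated by the operators \<open>exp (ad A)\<close> with \<open>A \<in> S\<close>. The compact group \<open>G\<close> corresponds to
  \<open>S = {A. \<sigma> A = A}\<close> and its complexification to \<open>S = UNIV\<close>.
\<close>

inductive_set adjoint_group ::
    "('n::finite) bracket \<Rightarrow> (complex ^ 'n) set \<Rightarrow> (complex ^ 'n \<Rightarrow> complex ^ 'n) set"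
  for br :: "('n::finite) bracket" and S :: "(complex ^ 'n) set" where
  id: "id \<in> adjoint_group br S"
| step: "A \<in> S \<Longrightarrow> u \<in> adjoint_group br S \<Longrightarrow> exp_ad br A \<circ> u \<in> adjoint_group br S"

definition adjoint_orbit :: "('n::finite) bracket \<Rightarrow> complex ^ 'n \<Rightarrow> (complex ^ 'n) set" where
  "adjoint_orbit br X = {u X |u. u \<in> adjoint_group br UNIV}"

definition orbit_tangent :: "('n::finite) bracket \<Rightarrow> complex ^ 'n \<Rightarrow> (complex ^ 'n) set" where
  "orbit_tangent br X = range (\<lambda>A. br A X)"

section \<open>Differential geometry of submanifolds of a Euclidean space\<close>

text \<open>
  Below, \<open>M\<close> is a submanifold of a Euclidean space and \<open>T x\<close> its tangent space at \<open>x \<in> M\<close>.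
  Tensor fields are given on tangent vectors at points of \<open>M\<close>; their values elsewhere are irrelevant.
\<close>

primrec Ck_on :: "nat \<Rightarrow> 'a set \<Rightarrow> ('a::euclidean_space \<Rightarrow> 'b::euclidean_space) \<Rightarrow> bool" where
  "Ck_on 0 U f \<longleftrightarrow> continuous_on U f"
| "Ck_on (Suc k) U f \<longleftrightarrow>
     (\<forall>x\<in>U. f differentiable (at x)) \<and> (\<forall>v. Ck_on k U (\<lambda>x. frechet_derivative f (at x) v))"

definition smooth_fun :: "'a set \<Rightarrow> ('a::euclidean_space \<Rightarrow> 'b::euclidean_space) \<Rightarrow> bool" where
  "smooth_fun M f \<longleftrightarrow>
     (\<forall>x\<in>M. \<exists>U f'. open U \<and> x \<in> U \<and> (\<forall>k. Ck_on k U f') \<and> (\<forall>y\<in>U \<inter> M. f y = f' y))"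

definition smooth_vfield ::
    "'a set \<Rightarrow> ('a \<Rightarrow> 'a set) \<Rightarrow> ('a::euclidean_space \<Rightarrow> 'a) \<Rightarrow> bool" where
  "smooth_vfield M T Y \<longleftrightarrow> smooth_fun M Y \<and> (\<forall>x\<in>M. Y x \<in> T x)"

text \<open>
  Derivatives within \<open>M\<close> of a smooth function on \<open>M\<close> are not unique as linear maps of the ambient
  space, but all of them agree on vectors tangent to \<open>M\<close>.
\<close>

definition dir_deriv ::
    "'a set \<Rightarrow> ('a::euclidean_space \<Rightarrow> 'b::euclidean_space) \<Rightarrow> 'a \<Rightarrow> 'a \<Rightarrow> 'b" where
  "dir_deriv M f x v = frechet_derivative f (at x within M) v"

definition vf_bracket ::
    "'a set \<Rightarrow> ('a::euclidean_space \<Rightarrow> 'a) \<Rightarrow> ('a \<Rightarrow> 'a) \<Rightarrow> 'a \<Rightarrow> 'a" where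
  "vf_bracket M Y Z x = dir_deriv M Z x (Y x) - dir_deriv M Y x (Z x)"

definition ext_deriv1 ::
    "'a set \<Rightarrow> ('a::euclidean_space \<Rightarrow> 'a \<Rightarrow> real) \<Rightarrow> ('a \<Rightarrow> 'a) \<Rightarrow> ('a \<Rightarrow> 'a) \<Rightarrow> 'a \<Rightarrow> real" where
  "ext_deriv1 M \<theta> Y Z x =
     dir_deriv M (\<lambda>y. \<theta> y (Z y)) x (Y x) - dir_deriv M (\<lambda>y. \<theta> y (Y y)) x (Z x)
     - \<theta> x (vf_bracket M Y Z x)"

definition ext_deriv2 ::
    "'a set \<Rightarrow> ('a::euclidean_space \<Rightarrow> 'a \<Rightarrow> 'a \<Rightarrow> real) \<Rightarrow>
     ('a \<Rightarrow> 'a) \<Rightarrow> ('a \<Rightarrow> 'a) \<Rightarrow> ('a \<Rightarrow> 'a) \<Rightarrow> 'a \<Rightarrow> real" where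
  "ext_deriv2 M \<omega> X Y Z x =
     dir_deriv M (\<lambda>y. \<omega> y (Y y) (Z y)) x (X x)
     + dir_deriv M (\<lambda>y. \<omega> y (Z y) (X y)) x (Y x)
     + dir_deriv M (\<lambda>y. \<omega> y (X y) (Y y)) x (Z x)
     - \<omega> x (vf_bracket M X Y x) (Z x)
     - \<omega> x (vf_bracket M Y Z x) (X x)
     - \<omega> x (vf_bracket M Z X x) (Y x)"

definition closed_form2 ::
    "'a set \<Rightarrow> ('a \<Rightarrow> 'a set) \<Rightarrow> ('a::euclidean_space \<Rightarrow> 'a \<Rightarrow> 'a \<Rightarrow> real) \<Rightarrow> bool" where
  "closed_form2 M T \<omega> \<longleftrightarrow>
     (\<forall>X Y Z. smooth_vfield M T X \<and> smooth_vfield M T Y \<and> smooth_vfield M T Z \<longrightarrow>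
        (\<forall>x\<in>M. ext_deriv2 M \<omega> X Y Z x = 0))"

definition riemannian_metric ::
    "'a set \<Rightarrow> ('a \<Rightarrow> 'a set) \<Rightarrow> ('a::euclidean_space \<Rightarrow> 'a \<Rightarrow> 'a \<Rightarrow> real) \<Rightarrow> bool" where
  "riemannian_metric M T g \<longleftrightarrow>
     (\<forall>x\<in>M. \<forall>u\<in>T x. \<forall>v\<in>T x. \<forall>w\<in>T x. \<forall>r.
        g x (u + v) w = g x u w + g x v w \<and> g x (r *\<^sub>R u) w = r * g x u w \<and> g x u v = g x v u) \<and>
     (\<forall>x\<in>M. \<forall>u\<in>T x. u \<noteq> 0 \<longrightarrow> g x u u > 0) \<and>
     (\<forall>Y Z. smooth_vfield M T Y \<and> smooth_vfield M T Z \<longrightarrow> smooth_fun M (\<lambda>x. g x (Y x) (Z x)))"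

definition almost_complex_structure ::
    "'a set \<Rightarrow> ('a \<Rightarrow> 'a set) \<Rightarrow> ('a::euclidean_space \<Rightarrow> 'a \<Rightarrow> 'a) \<Rightarrow> bool" where
  "almost_complex_structure M T J \<longleftrightarrow>
     (\<forall>x\<in>M. \<forall>u\<in>T x. \<forall>v\<in>T x. \<forall>r.
        J x u \<in> T x \<and> J x (u + v) = J x u + J x v \<and> J x (r *\<^sub>R u) = r *\<^sub>R J x u \<and>
        J x (J x u) = - u) \<and>
     (\<forall>Y. smooth_vfield M T Y \<longrightarrow> smooth_vfield M T (\<lambda>x. J x (Y x)))"

definition nijenhuis ::
    "'a set \<Rightarrow> ('a::euclidean_space \<Rightarrow> 'a \<Rightarrow> 'a) \<Rightarrow> ('a \<Rightarrow> 'a) \<Rightarrow> ('a \<Rightarrow> 'a) \<Rightarrow> 'a \<Rightarrow> 'a" where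
  "nijenhuis M J Y Z x =
     vf_bracket M (\<lambda>y. J y (Y y)) (\<lambda>y. J y (Z y)) x
     - J x (vf_bracket M (\<lambda>y. J y (Y y)) Z x)
     - J x (vf_bracket M Y (\<lambda>y. J y (Z y)) x)
     - vf_bracket M Y Z x"

text \<open>Integrability is expressed by the vanishing of the Nijenhuis tensor.\<close>

definition complex_structure ::
    "'a set \<Rightarrow> ('a \<Rightarrow> 'a set) \<Rightarrow> ('a::euclidean_space \<Rightarrow> 'a \<Rightarrow> 'a) \<Rightarrow> bool" where
  "complex_structure M T J \<longleftrightarrow>
     almost_complex_structure M T J \<and>
     (\<forall>Y Z. smooth_vfield M T Y \<and> smooth_vfield M T Z \<longrightarrow> (\<forall>x\<in>M. nijenhuis M J Y Z x = 0))"

definition kahler_form ::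
    "('a \<Rightarrow> 'a \<Rightarrow> 'a \<Rightarrow> real) \<Rightarrow> ('a \<Rightarrow> 'a \<Rightarrow> 'a) \<Rightarrow> 'a \<Rightarrow> 'a \<Rightarrow> 'a \<Rightarrow> real" where
  "kahler_form g J x u v = g x u (J x v)"

definition kahler ::
    "'a set \<Rightarrow> ('a \<Rightarrow> 'a set) \<Rightarrow> ('a::euclidean_space \<Rightarrow> 'a \<Rightarrow> 'a \<Rightarrow> real) \<Rightarrow> ('a \<Rightarrow> 'a \<Rightarrow> 'a) \<Rightarrow> bool" where
  "kahler M T g J \<longleftrightarrow>
     complex_structure M T J \<and>
     (\<forall>x\<in>M. \<forall>u\<in>T x. \<forall>v\<in>T x. g x (J x u) (J x v) = g x u v) \<and>
     closed_form2 M T (kahler_form g J)"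

definition hyperkahler ::
    "'a set \<Rightarrow> ('a \<Rightarrow> 'a set) \<Rightarrow> ('a::euclidean_space \<Rightarrow> 'a \<Rightarrow> 'a \<Rightarrow> real) \<Rightarrow>
     ('a \<Rightarrow> 'a \<Rightarrow> 'a) \<Rightarrow> ('a \<Rightarrow> 'a \<Rightarrow> 'a) \<Rightarrow> ('a \<Rightarrow> 'a \<Rightarrow> 'a) \<Rightarrow> bool" where
  "hyperkahler M T g I J K \<longleftrightarrow>
     riemannian_metric M T g \<and>
     kahler M T g I \<and> kahler M T g J \<and> kahler M T g K \<and>
     (\<forall>x\<in>M. \<forall>u\<in>T x. I x (J x u) = K x u \<and> J x (I x u) = - K x u)"

text \<open>\<open>\<omega>\<^sub>I = - 1/2 d (I d\<rho>)\<close>, with \<open>(I \<theta>) Y = - \<theta> (I Y)\<close> for a one-form \<open>\<theta>\<close>.\<close>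

definition kahler_potential ::
    "'a set \<Rightarrow> ('a \<Rightarrow> 'a set) \<Rightarrow> ('a::euclidean_space \<Rightarrow> 'a \<Rightarrow> 'a \<Rightarrow> real) \<Rightarrow>
     ('a \<Rightarrow> 'a \<Rightarrow> 'a) \<Rightarrow> ('a \<Rightarrow> real) \<Rightarrow> bool" where
  "kahler_potential M T g I \<rho> \<longleftrightarrow>
     smooth_fun M \<rho> \<and>
     (\<forall>Y Z. smooth_vfield M T Y \<and> smooth_vfield M T Z \<longrightarrow>
        (\<forall>x\<in>M. kahler_form g I x (Y x) (Z x) =
           - (1 / 2) * ext_deriv1 M (\<lambda>y v. - dir_deriv M \<rho> y (I y v)) Y Z x))"

section \<open>Structures on adjoint orbits\<close>

definition orbit_I :: "complex ^ 'n \<Rightarrow> complex ^ 'n \<Rightarrow> complex ^ ('n::finite)" where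
  "orbit_I X v = \<i> *s v"

text \<open>Compatibility \<open>\<omega>\<^sub>c = \<omega>\<^sub>J + \<i> \<omega>\<^sub>K\<close> with the Kirillov-Kostant-Souriau form
  \<open>\<omega>\<^sub>c (\<xi>\<^sub>A, \<xi>\<^sub>B) = \<langle>X, [A, B]\<rangle>\<close>, where \<open>\<xi>\<^sub>A = [A, X]\<close>.\<close>

definition kks_compatible ::
    "('n::finite) bracket \<Rightarrow> (complex ^ 'n) set \<Rightarrow>
     (complex ^ 'n \<Rightarrow> complex ^ 'n \<Rightarrow> complex ^ 'n \<Rightarrow> real) \<Rightarrow>
     (complex ^ 'n \<Rightarrow> complex ^ 'n \<Rightarrow> complex ^ 'n) \<Rightarrow>
     (complex ^ 'n \<Rightarrow> complex ^ 'n \<Rightarrow> complex ^ 'n) \<Rightarrow> bool" where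
  "kks_compatible br M g J K \<longleftrightarrow>
     (\<forall>X\<in>M. \<forall>A B.
        ip br X (br A B) =
          complex_of_real (kahler_form g J X (br A X) (br B X))
          + \<i> * complex_of_real (kahler_form g K X (br A X) (br B X)))"

definition G_invariant ::
    "('n::finite) bracket \<Rightarrow> (complex ^ 'n \<Rightarrow> complex ^ 'n) \<Rightarrow> (complex ^ 'n) set \<Rightarrow>
     (complex ^ 'n \<Rightarrow> real) \<Rightarrow> bool" where
  "G_invariant br \<sigma> M \<rho> \<longleftrightarrow>
     (\<forall>u\<in>adjoint_group br {A. \<sigma> A = A}. \<forall>X\<in>M. \<rho> (u X) = \<rho> X)"

end

theory Submission
  imports Defs
begin

text \<open>
  The proof is pointwise. A highest root vector \<open>E\<close> satisfies
  \<open>[E, [E, A]] = (2 / \<lambda>\<^sup>2) \<langle>E, A\<rangle> E\<close>, and this identity is invariant under the adjoint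
  group, so every point of the orbit has the form \<open>X = t E\<close> where \<open>E\<close> and \<open>F = - \<sigma> E\<close> generate an
  \<open>sl\<^sub>2\<close>-triple. For such a triple each tangent vector is \<open>[B, X] + r X\<close> with \<open>\<sigma> B = B\<close> and \<open>r\<close>
  real, so the differential of an invariant function is a multiple of \<open>d\<eta>\<close>. Applied to \<open>\<rho>\<close> and to
  its radial derivative, this gives real coefficients \<open>m\<close>, \<open>q\<close> with
  \<open>g (u, v) = Re (m \<langle>u, \<sigma> v\<rangle> + q \<langle>u, \<sigma> X\<rangle> \<langle>\<sigma> v, X\<rangle>)\<close> at \<open>X\<close>. Compatibility with \<open>\<omega>\<^sub>c\<close> and
  \<open>J\<^sup>2 = - 1\<close> then yield \<open>J v = - m [X, \<sigma> v] - q \<langle>\<sigma> v, X\<rangle> [X, \<sigma> X]\<close>. Evaluating \<open>J\<^sup>2 = - 1\<close> on \<open>X\<close>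
  and on a tangent vector of weight one for the triple, which exists because the algebra is not
  \<open>sl\<^sub>2\<close>, determines \<open>q\<close> and \<open>m\<^sup>2\<close>; positivity of \<open>g\<close> fixes the sign of \<open>m\<close>.
\<close>

section \<open>Invariant forms and compact real structures\<close>

lemma scaleR_eq_of_real: "r *\<^sub>R (x :: complex ^ 'n) = complex_of_real r *s x"
  by (simp add: vec_eq_iff vector_scalar_mult_def scaleR_conv_of_real[where 'a = complex])

lemma matrix_mult_distrib:
  fixes A B :: "complex ^ 'n ^ 'm" and C :: "complex ^ 'k ^ 'n"
  shows "(A + B) ** C = A ** C + B ** C" and "(A - B) ** C = A ** C - B ** C"
  by (simp_all add: matrix_eq matrix_vector_mul_assoc[symmetric] matrix_vector_mult_add_rdistrib
      matrix_vector_mult_diff_rdistrib)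

lemma linear_vec_scaleR:
  assumes "Vector_Spaces.linear (*s) (*s) (f :: complex ^ 'n \<Rightarrow> complex ^ 'm)"
  shows "linear f"
proof -
  interpret f: Vector_Spaces.linear "(*s)" "(*s)" f by fact
  show ?thesis by (rule linearI) (simp_all add: scaleR_eq_of_real f.add f.scale)
qed

section \<open>Bracket calculus and invariance of the Killing form\<close>

locale complex_lie_algebra =
  fixes br :: "('n::finite) bracket"
  assumes lie: "lie_algebra br"
begin

lemma linear_right: "Vector_Spaces.linear (*s) (*s) (br A)"
  using lie by (simp add: lie_algebra_def)

lemma linear_left: "Vector_Spaces.linear (*s) (*s) (\<lambda>A. br A B)"
  using lie by (simp add: lie_algebra_def)

sublocale R: Vector_Spaces.linear "(*s)" "(*s)" "br A" for A
  by (rule linear_right)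

sublocale L: Vector_Spaces.linear "(*s)" "(*s)" "\<lambda>A. br A B" for B
  by (rule linear_left)

lemmas br_linear = R.add L.add R.diff L.diff R.neg L.neg R.scale L.scale R.zero L.zero

lemma br_self [simp]: "br A A = 0"
  using lie by (simp add: lie_algebra_def)

lemma br_skew: "br A B = - br B A"
proof -
  have "br (A + B) (A + B) = br A B + br B A" by (simp add: br_linear del: br_self) simp
  then show ?thesis by (simp add: eq_neg_iff_add_eq_0)
qed

lemma jacobi: "br (br A B) C = br A (br B C) - br B (br A C)"
proof -
  have "br A (br B C) + br B (br C A) + br C (br A B) = 0"
    using lie by (simp add: lie_algebra_def)
  moreover have "br C (br A B) = - br (br A B) C" by (rule br_skew)
  moreover have "br B (br C A) = - br B (br A C)"
    by (subst br_skew[of C A]) (simp add: br_linear)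
  ultimately show ?thesis by (simp add: algebra_simps)
qed

lemma bounded_bilinear_br: "bounded_bilinear br"
  unfolding bilinear_conv_bounded_bilinear[symmetric] bilinear_def
  using linear_vec_scaleR[OF linear_right] linear_vec_scaleR[OF linear_left] by blast

sublocale br: bounded_bilinear br by (rule bounded_bilinear_br)

definition ad :: "complex ^ 'n \<Rightarrow> complex ^ 'n ^ 'n" where "ad A = matrix (br A)"

lemma ad_works: "ad A *v C = br A C"
  unfolding ad_def by (rule matrix_works) (rule linear_right)

lemma ad_add: "ad (A + B) = ad A + ad B"
  by (simp add: matrix_eq ad_works matrix_vector_mult_add_rdistrib br_linear)

lemma ad_br: "ad (br A B) = ad A ** ad B - ad B ** ad A"
  by (simp add: matrix_eq ad_works matrix_vector_mult_diff_rdistrib matrix_vector_mul_assoc[symmetric] jacobi)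

lemma killing_ad: "killing br A B = trace (ad A ** ad B)"
proof -
  have "(\<lambda>C. br A (br B C)) = (*v) (ad A ** ad B)"
    by (simp add: fun_eq_iff ad_works matrix_vector_mul_assoc[symmetric])
  then show ?thesis by (simp add: killing_def)
qed

lemma ip_sym: "ip br A B = ip br B A"
  unfolding ip_def killing_ad by (subst trace_mul_sym) (rule refl)

lemma ip_add_left: "ip br (A + B) C = ip br A C + ip br B C"
  by (simp add: ip_def killing_ad ad_add matrix_mult_distrib trace_add)

lemma ip_scale_left: "ip br (c *s A) C = c * ip br A C"
  unfolding ip_def killing_def trace_def matrix_def
  by (simp add: br_linear sum_distrib_left)

lemma ip_add_right: "ip br C (A + B) = ip br C A + ip br C B"
  by (metis ip_sym ip_add_left)

lemma ip_scale_right: "ip br C (c *s A) = c * ip br C A"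
  by (metis ip_sym ip_scale_left)

lemma ip_zero [simp]: "ip br 0 A = 0" "ip br A 0 = 0"
  using ip_scale_left[of 0 0 A] ip_scale_right[of A 0 0] by simp_all

lemma ip_minus_left: "ip br (- A) C = - ip br A C"
  using ip_scale_left[of "-1" A C] by simp

lemma ip_minus_right: "ip br C (- A) = - ip br C A"
  by (metis ip_sym ip_minus_left)

lemma ip_diff_left: "ip br (A - B) C = ip br A C - ip br B C"
  using ip_add_left[of A "- B" C] by (simp add: ip_minus_left)

lemma ip_diff_right: "ip br C (A - B) = ip br C A - ip br C B"
  by (metis ip_sym ip_diff_left)

lemmas ip_linear = ip_add_left ip_add_right ip_scale_left ip_scale_right
  ip_minus_left ip_minus_right ip_diff_left ip_diff_right

text \<open>Both sides expand into traces of triple products of \<open>ad A\<close>,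
  \<open>ad B\<close>, \<open>ad C\<close>, which agree up to cyclic permutation.\<close>

lemma ip_invariant: "ip br (br A B) C = ip br A (br B C)"
proof -
  have "killing br (br A B) C = trace (ad A ** ad B ** ad C) - trace (ad B ** ad A ** ad C)"
    by (simp add: killing_ad ad_br matrix_mult_distrib trace_sub)
  also have "trace (ad B ** ad A ** ad C) = trace (ad C ** ad B ** ad A)"
    by (metis matrix_mul_assoc trace_mul_sym)
  also have "trace (ad A ** ad B ** ad C) = trace (ad B ** ad C ** ad A)"
    by (metis matrix_mul_assoc trace_mul_sym)
  also have "trace (ad B ** ad C ** ad A) - trace (ad C ** ad B ** ad A) = killing br (br B C) A"
    by (simp add: killing_ad ad_br matrix_mult_distrib trace_sub)
  finally show ?thesis
    using ip_sym[of "br B C" A] by (simp add: ip_def)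
qed

lemma ip_ad_skew: "ip br (br A B) C = - ip br B (br A C)"
  using ip_invariant[of B A C] br_skew[of A B] by (simp add: ip_linear)

lemma bounded_bilinear_ip: "bounded_bilinear (ip br)"
  unfolding bilinear_conv_bounded_bilinear[symmetric] bilinear_def
  by (auto intro!: linearI simp: ip_linear scaleR_eq_of_real scaleR_conv_of_real)

sublocale ip: bounded_bilinear "ip br" by (rule bounded_bilinear_ip)

end

section \<open>Reality and positivity of the form relative to the compact structure\<close>

definition cnj_vec :: "complex ^ 'n \<Rightarrow> complex ^ 'n" where
  "cnj_vec x = (\<chi> i. cnj (x $ i))"

definition cnj_mat :: "complex ^ 'n ^ 'm \<Rightarrow> complex ^ 'n ^ 'm" where
  "cnj_mat S = (\<chi> i j. cnj (S $ i $ j))"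

lemma cnj_vec_mult: "cnj_vec (S *v x) = cnj_mat S *v cnj_vec x"
  by (simp add: cnj_vec_def cnj_mat_def matrix_vector_mult_def vec_eq_iff)

lemma cnj_vec_cnj_vec [simp]: "cnj_vec (cnj_vec x) = x"
  by (simp add: cnj_vec_def)

lemma trace_cnj_mat: "trace (cnj_mat S) = cnj (trace S)"
  by (simp add: trace_def cnj_mat_def)

locale compact_structure = complex_lie_algebra br for br :: "('n::finite) bracket" +
  fixes \<sigma> :: "complex ^ 'n \<Rightarrow> complex ^ 'n"
  assumes compact: "compact_real_structure br \<sigma>"
begin

lemma
  shows \<sigma>_add: "\<sigma> (A + B) = \<sigma> A + \<sigma> B"
    and \<sigma>_scale: "\<sigma> (c *s A) = cnj c *s \<sigma> A"
    and \<sigma>_\<sigma> [simp]: "\<sigma> (\<sigma> A) = A"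
    and \<sigma>_br: "\<sigma> (br A B) = br (\<sigma> A) (\<sigma> B)"
  using compact by (simp_all add: compact_real_structure_def)

lemma killing_neg: "\<sigma> A = A \<Longrightarrow> A \<noteq> 0 \<Longrightarrow> Re (killing br A A) < 0"
  using compact by (simp add: compact_real_structure_def)

lemma \<sigma>_zero [simp]: "\<sigma> 0 = 0"
  using \<sigma>_scale[of 0 0] by simp

lemma \<sigma>_minus: "\<sigma> (- A) = - \<sigma> A"
  using \<sigma>_scale[of "-1" A] by simp

lemma \<sigma>_diff: "\<sigma> (A - B) = \<sigma> A - \<sigma> B"
  using \<sigma>_add[of A "- B"] by (simp add: \<sigma>_minus)

lemmas \<sigma>_linear = \<sigma>_add \<sigma>_scale \<sigma>_minus \<sigma>_diff

lemma linear_\<sigma>: "linear \<sigma>"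
  by (rule linearI) (simp_all add: scaleR_eq_of_real \<sigma>_linear)

lemma bounded_linear_\<sigma>: "bounded_linear \<sigma>"
  using linear_\<sigma> by (simp add: linear_conv_bounded_linear)

text \<open>Writing the antilinear \<open>\<sigma>\<close> as a matrix \<open>S\<close> after
  entrywise conjugation, \<open>ad (\<sigma> A) ** ad (\<sigma> B)\<close> becomes a conjugate by
  \<open>S\<close> of the entrywise conjugate of \<open>ad A ** ad B\<close>. The trace ignores the
  conjugation by \<open>S\<close>.\<close>

lemma killing_\<sigma>: "killing br (\<sigma> A) (\<sigma> B) = cnj (killing br A B)"
proof -
  define S where "S = matrix (\<lambda>x. \<sigma> (cnj_vec x))"
  have "Vector_Spaces.linear (*s) (*s) (\<lambda>x. \<sigma> (cnj_vec x))"
  proof (intro Vector_Spaces.linear_iff[THEN iffD2] conjI allI)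
    show "vector_space ((*s) :: complex \<Rightarrow> complex ^ 'n \<Rightarrow> _)" by unfold_locales
    then show "vector_space ((*s) :: complex \<Rightarrow> complex ^ 'n \<Rightarrow> _)" .
    fix x y c
    have "cnj_vec (x + y) = cnj_vec x + cnj_vec y" "cnj_vec (c *s x) = cnj c *s cnj_vec x"
      for x y :: "complex ^ 'n" by (simp_all add: cnj_vec_def vec_eq_iff)
    then show "\<sigma> (cnj_vec (x + y)) = \<sigma> (cnj_vec x) + \<sigma> (cnj_vec y)"
      "\<sigma> (cnj_vec (c *s x)) = c *s \<sigma> (cnj_vec x)"
      by (simp_all add: \<sigma>_linear)
  qed
  then have S: "S *v x = \<sigma> (cnj_vec x)" for x
    unfolding S_def by (rule matrix_works)
  then have \<sigma>S: "\<sigma> x = S *v cnj_vec x" for x by simp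
  have "S ** cnj_mat S = mat 1"
    unfolding matrix_eq
    by (metis \<sigma>S \<sigma>_\<sigma> cnj_vec_cnj_vec cnj_vec_mult matrix_vector_mul_assoc matrix_vector_mul_lid)
  then have inv: "cnj_mat S ** S = mat 1"
    by (simp add: matrix_left_right_inverse)
  define N where "N = ad A ** ad B"
  have N: "N *v x = br A (br B x)" for x
    by (simp add: N_def matrix_vector_mul_assoc[symmetric] ad_works)
  have "ad (\<sigma> A) ** ad (\<sigma> B) = S ** cnj_mat N ** cnj_mat S"
  proof (unfold matrix_eq, intro allI)
    fix x
    have "(ad (\<sigma> A) ** ad (\<sigma> B)) *v x = \<sigma> (N *v \<sigma> x)"
      by (simp add: matrix_vector_mul_assoc[symmetric] ad_works \<sigma>_br N)
    also have "\<dots> = (S ** cnj_mat N ** cnj_mat S) *v x"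
      by (simp only: \<sigma>S cnj_vec_mult matrix_vector_mul_assoc[symmetric] cnj_vec_cnj_vec)
    finally show "(ad (\<sigma> A) ** ad (\<sigma> B)) *v x = (S ** cnj_mat N ** cnj_mat S) *v x" .
  qed
  moreover have "trace (S ** cnj_mat N ** cnj_mat S) = trace (cnj_mat N)"
    by (metis inv matrix_mul_assoc matrix_mul_lid trace_mul_sym)
  ultimately show ?thesis
    by (simp add: killing_ad trace_cnj_mat N_def)
qed

lemma ip_\<sigma>: "ip br (\<sigma> A) (\<sigma> B) = cnj (ip br A B)"
  by (simp add: ip_def killing_\<sigma>)

lemma ip_\<sigma>': "ip br (\<sigma> A) B = cnj (ip br A (\<sigma> B))"
  using ip_\<sigma>[of A "\<sigma> B"] by simp

lemma ip_eta: "ip br A (\<sigma> A) = complex_of_real (eta br \<sigma> A)"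
proof -
  have "cnj (ip br A (\<sigma> A)) = ip br A (\<sigma> A)" using ip_\<sigma>'[of A A] ip_sym by simp
  then show ?thesis by (simp add: eta_def complex_eq_iff)
qed

text \<open>Splitting \<open>A = B + \<i> *s C\<close> with \<open>B\<close> and \<open>C\<close> in
  the real form, the mixed terms cancel by symmetry and \<open>eta\<close> is a sum of two values of
  the definite form.\<close>

lemma eta_pos:
  assumes "A \<noteq> 0" shows "eta br \<sigma> A > 0"
proof -
  define B where "B = (1/2) *s (A + \<sigma> A)"
  define C where "C = (- \<i>/2) *s (A - \<sigma> A)"
  have B: "\<sigma> B = B" and C: "\<sigma> C = C"
    by (simp_all add: B_def C_def \<sigma>_linear vec_eq_iff field_simps)
  have A: "A = B + \<i> *s C" by (simp add: B_def C_def vec_eq_iff algebra_simps)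
  have nn: "D = 0 \<or> Re (ip br D D) > 0" if "\<sigma> D = D" for D
    using killing_neg[OF that] by (auto simp: ip_def)
  have "ip br A (\<sigma> A) = ip br B B + ip br C C"
    unfolding A by (simp add: \<sigma>_linear B C ip_linear ip_sym algebra_simps)
  then have "eta br \<sigma> A = Re (ip br B B) + Re (ip br C C)" by (simp add: eta_def)
  moreover have "B \<noteq> 0 \<or> C \<noteq> 0" using assms A by auto
  ultimately show ?thesis using nn[OF B] nn[OF C]
    by (smt (verit) ip_zero(1) zero_complex.simps(1))
qed

text \<open>The test vector \<open>\<sigma> A\<close> detects \<open>A\<close>, by
  \<open>eta_pos\<close>.\<close>

lemma ip_nondegenerate:
  assumes "\<And>B. ip br A B = 0" shows "A = 0"
  using assms[of "\<sigma> A"] eta_pos[of A] by (auto simp: eta_def)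

lemma ip_cancel:
  assumes "\<And>C. ip br C A = ip br C B" shows "A = B"
  using ip_nondegenerate[of "A - B"] assms by (simp add: ip_linear ip_sym)

lemma eta_scaleR: "eta br \<sigma> (r *\<^sub>R A) = r\<^sup>2 * eta br \<sigma> A"
  by (simp add: eta_def scaleR_eq_of_real \<sigma>_linear ip_linear power2_eq_square)

end

section \<open>The adjoint exponential\<close>

text \<open>A Gronwall argument. It later yields identities for \<open>exp_ad\<close> without
  multiplying power series.\<close>

lemma linear_ode_unique:
  fixes w :: "real \<Rightarrow> 'a::euclidean_space"
  assumes D: "bounded_linear D"
    and w: "\<And>t. (w has_vector_derivative D (w t)) (at t)"
    and "w 0 = 0" and "t \<ge> 0"
  shows "w t = 0"
proof -
  obtain K where K: "\<And>x. norm (D x) \<le> norm x * K"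
    using bounded_linear.bounded[OF D] by blast
  \<comment> \<open>With \<open>K\<close> bounding \<open>D\<close>, the squared norm grows at most
    at rate \<open>2 * K\<close>, so this weight makes it nonincreasing.\<close>
  define N where "N s = (w s \<bullet> w s) * exp (- (2 * K * s))" for s
  have "N t \<le> N 0"
  proof (rule DERIV_nonpos_imp_nonincreasing[OF \<open>t \<ge> 0\<close>], intro exI conjI)
    fix s
    have 1: "((\<lambda>s. w s \<bullet> w s) has_real_derivative w s \<bullet> D (w s) + D (w s) \<bullet> w s) (at s)"
      using bounded_bilinear.has_vector_derivative[OF bounded_bilinear_inner w[of s] w[of s]]
      by (simp add: has_real_derivative_iff_has_vector_derivative)
    show "(N has_real_derivative (w s \<bullet> w s) * (exp (- (2 * K * s)) * - (2 * K))
        + (w s \<bullet> D (w s) + D (w s) \<bullet> w s) * exp (- (2 * K * s))) (at s)"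
      unfolding N_def by (rule derivative_eq_intros 1 refl | simp)+
    have "w s \<bullet> D (w s) \<le> norm (w s) * norm (D (w s))" by (rule norm_cauchy_schwarz)
    also have "\<dots> \<le> norm (w s) * (norm (w s) * K)" by (intro mult_left_mono K norm_ge_zero)
    also have "\<dots> = (w s \<bullet> w s) * K" by (simp add: dot_square_norm power2_eq_square)
    finally have "2 * (w s \<bullet> D (w s)) - (w s \<bullet> w s) * (2 * K) \<le> 0" by simp
    then have "(2 * (w s \<bullet> D (w s)) - (w s \<bullet> w s) * (2 * K)) * exp (- (2 * K * s)) \<le> 0"
      by (rule mult_nonpos_nonneg) simp
    then show "(w s \<bullet> w s) * (exp (- (2 * K * s)) * - (2 * K))
        + (w s \<bullet> D (w s) + D (w s) \<bullet> w s) * exp (- (2 * K * s)) \<le> 0"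
      by (simp add: inner_commute algebra_simps)
  qed
  then have "w t \<bullet> w t * exp (- (2 * K * t)) \<le> 0" using \<open>w 0 = 0\<close> by (simp add: N_def)
  then have "w t \<bullet> w t \<le> 0" by (simp add: mult_le_0_iff not_le[symmetric])
  then show ?thesis by (meson inner_gt_zero_iff not_less)
qed

context complex_lie_algebra
begin

lemma ad_power_scaleR: "((br (t *\<^sub>R A)) ^^ k) X = (t ^ k) *\<^sub>R ((br A) ^^ k) X"
  by (induction k) (simp_all add: br.scaleR_left br.scaleR_right)

lemma summable_exp_ad: "summable (\<lambda>k. (1 / fact k) *\<^sub>R ((br A) ^^ k) X)"
proof -
  obtain K where K: "\<And>a b. norm (br a b) \<le> norm a * norm b * K"
    using br.bounded by blast
  define C where "C = norm A * K"
  have pow: "norm (((br A) ^^ k) X) \<le> \<bar>C\<bar> ^ k * norm X" for k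
  proof (induction k)
    case (Suc k)
    have "norm (br A (((br A) ^^ k) X)) \<le> C * norm (((br A) ^^ k) X)"
      using K[of A "((br A) ^^ k) X"] by (simp add: C_def mult_ac)
    also have "\<dots> \<le> \<bar>C\<bar> * (\<bar>C\<bar> ^ k * norm X)"
      using Suc by (intro mult_mono) auto
    finally show ?case by simp
  qed simp
  show ?thesis
  proof (rule summable_comparison_test)
    show "\<exists>N. \<forall>k\<ge>N. norm ((1 / fact k) *\<^sub>R ((br A) ^^ k) X) \<le> (inverse (fact k) * \<bar>C\<bar> ^ k) * norm X"
      using pow by (auto simp: divide_simps)
    show "summable (\<lambda>k. (inverse (fact k) * \<bar>C\<bar> ^ k) * norm X)"
      by (intro summable_mult2 summable_exp)
  qed
qed

lemma exp_ad_sums: "(\<lambda>k. (1 / fact k) *\<^sub>R ((br A) ^^ k) X) sums exp_ad br A X"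
  unfolding exp_ad_def by (rule summable_sums[OF summable_exp_ad])

lemma linear_ad_power: "linear ((br A) ^^ k)"
proof (induction k)
  case (Suc k)
  then show ?case
    using linear_compose[OF Suc linear_vec_scaleR[OF linear_right]] by (simp add: o_def)
qed (simp add: linear_id[unfolded id_def] id_def)

lemma linear_exp_ad: "linear (exp_ad br A)"
proof (rule linearI)
  fix x y and r :: real
  show "exp_ad br A (x + y) = exp_ad br A x + exp_ad br A y"
    using sums_add[OF exp_ad_sums[of A x] exp_ad_sums[of A y]] exp_ad_sums[of A "x + y"]
    by (simp add: linear_add[OF linear_ad_power] scaleR_add_right sums_unique2)
  show "exp_ad br A (r *\<^sub>R x) = r *\<^sub>R exp_ad br A x"
    using bounded_linear.sums[OF bounded_linear_scaleR_right exp_ad_sums[of A x], of r]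
      exp_ad_sums[of A "r *\<^sub>R x"]
    by (simp add: linear_scale[OF linear_ad_power] mult.commute sums_unique2)
qed

lemma exp_ad_commute: "exp_ad br A (br A X) = br A (exp_ad br A X)"
proof -
  have "((br A) ^^ k) (br A X) = br A (((br A) ^^ k) X)" for k
    by (simp add: funpow_swap1)
  then have "(\<lambda>k. (1 / fact k) *\<^sub>R ((br A) ^^ k) (br A X)) sums br A (exp_ad br A X)"
    using bounded_linear.sums[OF br.bounded_linear_right exp_ad_sums[of A X], of A]
    by (simp add: br.scaleR_right)
  then show ?thesis using exp_ad_sums sums_unique2 by blast
qed

lemma exp_ad_zero [simp]: "exp_ad br 0 X = X"
proof -
  have "(br 0 ^^ k) X = (if k = 0 then X else 0)" for k
    by (cases k) (simp_all add: br_linear)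
  then have "(\<lambda>k. (1 / fact k) *\<^sub>R ((br 0) ^^ k) X) = (\<lambda>k. if k = 0 then X else 0)"
    by auto
  moreover have "(\<lambda>k::nat. if k = 0 then X else 0) sums X"
    using sums_single[of 0 "\<lambda>_. X"] by simp
  ultimately show ?thesis using exp_ad_sums[of 0 X] sums_unique2 by metis
qed

text \<open>Each coordinate is an everywhere convergent power series in \<open>t\<close>. Termwise
  differentiation shifts its coefficients, which amounts to replacing \<open>X\<close> by
  \<open>br A X\<close>.\<close>

lemma exp_ad_has_vector_derivative:
  "((\<lambda>t. exp_ad br (t *\<^sub>R A) X) has_vector_derivative br A (exp_ad br (t *\<^sub>R A) X)) (at t)"
proof -
  define c where "c Y b k = (((br A) ^^ k) Y \<bullet> b) / fact k" for Y b k
  have sums: "(\<lambda>k. c Y b k * s ^ k) sums (exp_ad br (s *\<^sub>R A) Y \<bullet> b)" for Y b s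
    using bounded_linear.sums[OF bounded_linear_inner_left exp_ad_sums[of "s *\<^sub>R A" Y], of b]
    by (simp add: ad_power_scaleR c_def mult_ac)
  have deriv: "((\<lambda>s. exp_ad br (s *\<^sub>R A) X \<bullet> b) has_real_derivative
      br A (exp_ad br (t *\<^sub>R A) X) \<bullet> b) (at t)" for b
  proof -
    have "diffs (c X b) = c (br A X) b"
      by (rule ext) (simp add: diffs_def c_def funpow_swap1 del: of_nat_Suc)
    moreover have "exp_ad br (t *\<^sub>R A) (br A X) = br A (exp_ad br (t *\<^sub>R A) X)"
    \<comment> \<open>\<open>exp_ad_commute\<close> applies to \<open>t *\<^sub>R A\<close>, and the
      factor \<open>t\<close> must then be cancelled.\<close>
    proof (cases "t = 0")
      case False
      then show ?thesis
        using exp_ad_commute[of "t *\<^sub>R A" X]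
        by (simp add: br.scaleR_left linear_scale[OF linear_exp_ad])
    qed simp
    moreover have "((\<lambda>s. \<Sum>k. c X b k * s ^ k) has_real_derivative
        (\<Sum>k. diffs (c X b) k * t ^ k)) (at t)"
      by (rule termdiffs_strong_converges_everywhere) (rule sums_summable[OF sums])
    ultimately show ?thesis
      using sums_unique[OF sums, symmetric] by simp
  qed
  have "((\<lambda>s. exp_ad br (s *\<^sub>R A) X) has_derivative
      (\<lambda>r. r *\<^sub>R br A (exp_ad br (t *\<^sub>R A) X))) (at t within UNIV)"
  proof (rule has_derivative_componentwise_within[THEN iffD2], rule)
    fix b :: "complex ^ 'n"
    have "(\<lambda>r. (r *\<^sub>R br A (exp_ad br (t *\<^sub>R A) X)) \<bullet> b) =
        (*) (br A (exp_ad br (t *\<^sub>R A) X) \<bullet> b)"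
      by (simp add: fun_eq_iff)
    then show "((\<lambda>s. exp_ad br (s *\<^sub>R A) X \<bullet> b) has_derivative
        (\<lambda>r. (r *\<^sub>R br A (exp_ad br (t *\<^sub>R A) X)) \<bullet> b)) (at t within UNIV)"
      using deriv[of b] by (simp add: has_field_derivative_def)
  qed
  then show ?thesis by (simp add: has_vector_derivative_def)
qed

text \<open>By the Jacobi identity both sides, taken along \<open>t *\<^sub>R A\<close>, solve the
  same linear equation \<open>w' = [A, w]\<close> with the same initial value.\<close>

lemma exp_ad_br: "exp_ad br A (br X Y) = br (exp_ad br A X) (exp_ad br A Y)"
proof -
  define w where "w t = exp_ad br (t *\<^sub>R A) (br X Y)
      - br (exp_ad br (t *\<^sub>R A) X) (exp_ad br (t *\<^sub>R A) Y)" for t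
  have "w 1 = 0"
  proof (rule linear_ode_unique[of "br A" w 1])
    show "bounded_linear (br A)" by (rule br.bounded_linear_right)
    show "w 0 = 0" by (simp add: w_def)
    fix t
    show "(w has_vector_derivative br A (w t)) (at t)"
      unfolding w_def
      by (rule derivative_eq_intros bounded_bilinear.has_vector_derivative[OF bounded_bilinear_br]
          exp_ad_has_vector_derivative refl)+
        (simp add: br_linear jacobi)
  qed simp
  then show ?thesis by (simp add: w_def)
qed

text \<open>Skewness of \<open>br A\<close> makes the derivative of the pairing along the flow
  vanish.\<close>

lemma ip_exp_ad: "ip br (exp_ad br A X) (exp_ad br A Y) = ip br X Y"
proof -
  define f where "f t = ip br (exp_ad br (t *\<^sub>R A) X) (exp_ad br (t *\<^sub>R A) Y)" for t
  have f: "(f has_vector_derivative 0) (at t)" for t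
    unfolding f_def
    using bounded_bilinear.has_vector_derivative[OF bounded_bilinear_ip
        exp_ad_has_vector_derivative[of A X t] exp_ad_has_vector_derivative[of A Y t]]
    by (simp add: ip_ad_skew)
  have "\<exists>c. \<forall>t\<in>UNIV. f t = c"
    by (rule has_derivative_zero_constant) (use f in \<open>auto simp: has_vector_derivative_def\<close>)
  then have "f 1 = f 0" by auto
  then show ?thesis by (simp add: f_def)
qed

text \<open>The square of \<open>br X\<close> has rank at most one. Stated without reference to
  roots, the condition can be moved along the orbit.\<close>

definition minimal_vector :: "complex \<Rightarrow> complex ^ 'n \<Rightarrow> bool" where
  "minimal_vector c X \<longleftrightarrow> (\<forall>A. br X (br X A) = (c * ip br X A) *s X)"

end

section \<open>Minimal vectors along an adjoint orbit\<close>

context compact_structure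
begin

lemma exp_ad_eq_0: "exp_ad br A X = 0 \<Longrightarrow> X = 0"
  using ip_exp_ad[of A X] by (auto intro: ip_nondegenerate)

lemma surj_exp_ad: "surj (exp_ad br A)"
  using linear_exp_ad exp_ad_eq_0
  by (intro linear_injective_imp_surjective) (auto simp: linear_injective_0)

text \<open>\<open>linear_exp_ad\<close> concerns real scalars only. Complex homogeneity follows
  because \<open>exp_ad br A\<close> is onto and preserves a nondegenerate complex bilinear
  form.\<close>

lemma exp_ad_scale: "exp_ad br A (c *s X) = c *s exp_ad br A X"
proof (rule ip_cancel)
  fix Y
  obtain Z where "Y = exp_ad br A Z" using surj_exp_ad by blast
  then show "ip br Y (exp_ad br A (c *s X)) = ip br Y (c *s exp_ad br A X)"
    by (simp add: ip_exp_ad ip_linear)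
qed

text \<open>\<open>exp_ad br B\<close> is an automorphism preserving \<open>ip\<close>; being onto,
  it lets the test vector be written as an image.\<close>

lemma minimal_vector_exp_ad:
  assumes "minimal_vector c X" shows "minimal_vector c (exp_ad br B X)"
  unfolding minimal_vector_def
proof
  fix A
  obtain Z where "A = exp_ad br B Z" using surj_exp_ad by blast
  then show "br (exp_ad br B X) (br (exp_ad br B X) A) = (c * ip br (exp_ad br B X) A) *s exp_ad br B X"
    using assms by (simp add: exp_ad_br[symmetric] ip_exp_ad exp_ad_scale minimal_vector_def)
qed

lemma adjoint_orbit_exp_ad: "X \<in> adjoint_orbit br Y \<Longrightarrow> exp_ad br A X \<in> adjoint_orbit br Y"
proof -
  assume "X \<in> adjoint_orbit br Y"
  then obtain u where "u \<in> adjoint_group br UNIV" "X = u Y" by (auto simp: adjoint_orbit_def)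
  then have "exp_ad br A \<circ> u \<in> adjoint_group br UNIV" "exp_ad br A X = (exp_ad br A \<circ> u) Y"
    by (simp_all add: adjoint_group.step)
  then show ?thesis unfolding adjoint_orbit_def by blast
qed

lemma adjoint_orbit_minimal:
  assumes "X \<in> adjoint_orbit br Y" "minimal_vector c Y" "Y \<noteq> 0"
  shows "minimal_vector c X \<and> X \<noteq> 0"
proof -
  obtain u where "u \<in> adjoint_group br UNIV" "X = u Y"
    using assms(1) by (auto simp: adjoint_orbit_def)
  from this(1) have "minimal_vector c (u Y) \<and> u Y \<noteq> 0"
    by induction (use assms minimal_vector_exp_ad exp_ad_eq_0 in auto)
  then show ?thesis using \<open>X = u Y\<close> by simp
qed

end

section \<open>Highest root vectors and their compact \<open>sl\<^sub>2\<close>-triples\<close>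

text \<open>These assumptions hold for a positive multiple of every orbit point, so the pointwise
  computation can take place in one locale.\<close>

locale minimal_triple = compact_structure br \<sigma>
  for br :: "('n::finite) bracket" and \<sigma> +
  fixes L :: real and E :: "complex ^ 'n"
  assumes E_nonzero: "E \<noteq> 0"
    and eta_E: "eta br \<sigma> E = L"
    and minimal_E: "minimal_vector (2 / complex_of_real L) E"
begin

definition "F = - \<sigma> E"
definition "H = br E F"

lemma L_pos: "L > 0" using eta_pos[OF E_nonzero] eta_E by simp

lemma \<sigma>_E: "\<sigma> E = - F" and \<sigma>_F: "\<sigma> F = - E" and \<sigma>_H: "\<sigma> H = - H"
  using br_skew[of F E] by (simp_all add: F_def H_def \<sigma>_linear \<sigma>_br br_linear br_skew[of _ E])

lemma ip_EF: "ip br E F = - complex_of_real L" and ip_FE: "ip br F E = - complex_of_real L"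
  using ip_eta[of E] ip_sym[of F E] by (simp_all add: F_def eta_E ip_linear)

lemma br_EE: "br E (br E A) = (2 / L * ip br E A) *s E"
  using minimal_E by (simp add: minimal_vector_def)

lemma br_EF: "br E F = H" and br_FE: "br F E = - H"
  using br_skew[of F E] by (simp_all add: H_def)

text \<open>The constant \<open>2 / L\<close> against \<open>ip_EF\<close> gives exactly the
  coefficient of a standard triple.\<close>

lemma br_EH: "br E H = - 2 *s E"
  using L_pos unfolding H_def br_EE ip_EF by simp

lemma br_HE: "br H E = 2 *s E"
  using br_skew[of H E] br_EH by (simp add: vec_eq_iff)

lemma br_HF: "br H F = - 2 *s F"
proof -
  have "\<sigma> (br H E) = br H F" by (simp add: \<sigma>_br \<sigma>_E \<sigma>_H br_linear)
  then show ?thesis by (simp add: br_HE \<sigma>_linear \<sigma>_E vec_eq_iff)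
qed

lemma br_FH: "br F H = 2 *s F"
  using br_skew[of F H] br_HF by (simp add: vec_eq_iff)

lemma br_H: "br H A = br E (br F A) - br F (br E A)"
  unfolding H_def by (rule jacobi)

lemma ip_EE: "ip br E E = 0" using br_EE[of E] E_nonzero L_pos by (simp add: br_linear)

lemma ip_FF: "ip br F F = 0" using ip_\<sigma>[of E E] ip_EE by (simp add: \<sigma>_E ip_linear)

lemma ip_EH: "ip br E H = 0" and ip_HE: "ip br H E = 0"
  using ip_invariant[of E E F] ip_sym by (simp_all add: br_EF)

lemma ip_FH: "ip br F H = 0" and ip_HF: "ip br H F = 0"
  using ip_invariant[of E F F] ip_sym by (simp_all add: br_EF)

lemma ip_HH: "ip br H H = - 2 * complex_of_real L"
  using ip_invariant[of H E F] by (simp add: br_EF br_HE ip_linear ip_EF)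

lemmas triple_br = br_EF br_FE br_EH br_HE br_HF br_FH
lemmas triple_ip = ip_EE ip_FF ip_HH ip_EH ip_HE ip_FH ip_HF ip_EF ip_FE

text \<open>The orthogonal complement of the triple, stable under \<open>br E\<close>,
  \<open>br F\<close> and \<open>\<sigma>\<close>. As \<open>br E\<close> squares to zero on it,
  only trivial and two-dimensional representations of the triple occur.\<close>

definition perp :: "(complex ^ 'n) set" where
  "perp = {a. ip br E a = 0 \<and> ip br H a = 0 \<and> ip br F a = 0}"

lemma perp_ip: "a \<in> perp \<Longrightarrow> ip br E a = 0" "a \<in> perp \<Longrightarrow> ip br H a = 0" "a \<in> perp \<Longrightarrow> ip br F a = 0"
  by (simp_all add: perp_def)

lemma perp_br_E: "a \<in> perp \<Longrightarrow> br E a \<in> perp"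
  by (simp add: perp_def ip_invariant[symmetric] triple_br ip_linear)

lemma perp_br_F: "a \<in> perp \<Longrightarrow> br F a \<in> perp"
  by (simp add: perp_def ip_invariant[symmetric] triple_br ip_linear)

lemma perp_\<sigma>: "a \<in> perp \<Longrightarrow> \<sigma> a \<in> perp"
  using ip_\<sigma>[of E a] ip_\<sigma>[of H a] ip_\<sigma>[of F a]
  by (simp add: perp_def \<sigma>_E \<sigma>_F \<sigma>_H ip_linear)

text \<open>Coordinates of the orthogonal projection to the span of the triple; the denominators
  come from \<open>ip_EF\<close> and \<open>ip_HH\<close>.\<close>

definition "coE A = - ip br A F / L"
definition "coH A = - ip br A H / (2 * L)"
definition "coF A = - ip br A E / L"

lemma perp_decomposition:
  "A - (coE A *s E + coH A *s H + coF A *s F) \<in> perp"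
  using L_pos by (simp add: perp_def coE_def coF_def coH_def ip_linear triple_ip ip_sym[of _ A])

lemma decompose:
  obtains e h f a where "A = e *s E + h *s H + f *s F + a" "a \<in> perp"
  using perp_decomposition[of A] by (metis diff_add_cancel add.commute)

lemma perp_br_EE: "a \<in> perp \<Longrightarrow> br E (br E a) = 0"
  by (simp add: br_EE perp_ip)

text \<open>Since \<open>[E, [E, a]] = 0\<close>, this says that \<open>[E, a]\<close> has weight one under \<open>ad H\<close>.\<close>

lemma perp_weight:
  assumes "a \<in> perp" shows "br E (br F (br E a)) = br E a"
proof -
  have EEF: "br E (br E (br F a)) = 0" using perp_br_EE[OF perp_br_F[OF assms]] .
  \<comment> \<open>Expanding \<open>H = [E, F]\<close> on both sides leaves
    \<open>w = - w + 2 [E, a]\<close> for \<open>w = [E, [F, [E, a]]]\<close>, since terms with two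
    outer \<open>E\<close> vanish.\<close>
  have "br H (br E a) = br E (br H a) + br (br H E) a"
    by (simp add: jacobi)
  then have "br E (br F (br E a)) = br E (br H a) + 2 *s br E a"
    using perp_br_EE[OF assms] by (simp add: br_H[of "br E a"] br_HE br_linear)
  also have "br E (br H a) = - br E (br F (br E a))"
    by (simp add: br_H br_linear EEF)
  finally have "2 *s br E (br F (br E a)) = 2 *s br E a"
    by (simp add: vec_eq_iff algebra_simps)
  then show ?thesis by (simp add: vec_eq_iff)
qed

text \<open>Infinitesimally, the compact group and the real dilations sweep out the orbit, so an
  invariant function has only a radial derivative.\<close>

lemma tangent_decomposition:
  obtains B r where "\<sigma> B = B" "br A E = br B E + r *\<^sub>R E"
proof -
  obtain e k f a where A: "A = e *s E + k *s H + f *s F + a" and a: "a \<in> perp"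
    by (rule decompose)
  \<comment> \<open>\<open>x\<close> is the weight \<open>-1\<close> component of \<open>a\<close>, and \<open>\<sigma> x\<close> has weight \<open>1\<close>, hence commutes with \<open>E\<close>.\<close>
  define x where "x = br F (br E a)"
  have Ex: "br E x = br E a" by (simp add: x_def perp_weight a)
  have "\<sigma> x = br E (br F (\<sigma> a))" by (simp add: x_def \<sigma>_br \<sigma>_E \<sigma>_F br_linear)
  then have E\<sigma>x: "br E (\<sigma> x) = 0" using perp_br_EE[OF perp_br_F[OF perp_\<sigma>[OF a]]] by simp
  have xE: "br x E = br a E" "br (\<sigma> x) E = 0"
    using Ex E\<sigma>x br_skew[of _ E] by simp_all
  \<comment> \<open>Each group of terms is fixed by \<open>\<sigma>\<close>. The first two reproduce
    \<open>f *s F\<close> up to multiples of \<open>E\<close>, which commute with \<open>E\<close>;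
    the real part of \<open>k\<close> is left over as the dilation.\<close>
  define B where "B = (complex_of_real (Re f)) *s (F - E) + (\<i> * Im f) *s (F + E)
      + (\<i> * Im k) *s H + x + \<sigma> x"
  have "\<sigma> B = B"
    by (simp add: B_def \<sigma>_linear \<sigma>_E \<sigma>_F \<sigma>_H vec_eq_iff algebra_simps)
  moreover have "br A E = br B E + (2 * Re k) *\<^sub>R E"
  proof -
    have f: "complex_of_real (Re f) + \<i> * Im f = f" and k: "complex_of_real (Re k) + \<i> * Im k = k"
      by (simp_all add: complex_eq_iff)
    have BE: "br B E = - ((complex_of_real (Re f) + \<i> * Im f) *s H) + (2 * \<i> * Im k) *s E + br a E"
      by (simp add: B_def br_linear triple_br xE vec_eq_iff algebra_simps)
    have AE: "br A E = - (f *s H) + (2 * (complex_of_real (Re k) + \<i> * Im k)) *s E + br a E"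
      unfolding k by (simp add: A br_linear triple_br vec_eq_iff algebra_simps)
    show ?thesis
      unfolding AE BE f by (simp add: scaleR_eq_of_real vec_eq_iff algebra_simps)
  qed
  ultimately show ?thesis by (rule that)
qed

text \<open>If \<open>br E\<close> kills \<open>perp\<close>, then applying \<open>\<sigma>\<close>
  so does \<open>br F\<close>, hence also \<open>br H\<close>. The span of the triple is then a
  nonzero ideal, and simplicity makes it everything.\<close>

lemma perp_trivial_imp_spanning:
  assumes simple: "simple_lie_algebra br" and triv: "\<And>a. a \<in> perp \<Longrightarrow> br E a = 0"
  shows "A = coE A *s E + coH A *s H + coF A *s F"
proof -
  have trivF: "br F a = 0" if "a \<in> perp" for a
  proof -
    have "\<sigma> (br E (\<sigma> a)) = - br F a" by (simp add: \<sigma>_br \<sigma>_E br_linear)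
    then show ?thesis using triv[OF perp_\<sigma>[OF that]] by simp
  qed
  define S where "S = {e *s E + k *s H + f *s F | e k f. True}"
  have S_I: "e *s E + k *s H + f *s F \<in> S" for e k f by (auto simp: S_def)
  have "vec.subspace S"
  proof (rule vec.subspaceI)
    show "0 \<in> S" using S_I[of 0 0 0] by simp
    fix x y c assume "x \<in> S" "y \<in> S"
    then obtain e k f e' k' f' where "x = e *s E + k *s H + f *s F" "y = e' *s E + k' *s H + f' *s F"
      by (auto simp: S_def)
    then show "x + y \<in> S" "c *s x \<in> S"
      using S_I[of "e + e'" "k + k'" "f + f'"] S_I[of "c * e" "c * k" "c * f"]
      by (simp_all add: vec.scale_left_distrib vec.scale_right_distrib vec.scale_scale algebra_simps)
  qed
  moreover have "br A B \<in> S" if BS: "B \<in> S" for A B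
  proof -
    obtain e k f where B: "B = e *s E + k *s H + f *s F" using BS unfolding S_def by blast
    obtain e' k' f' a where A: "A = e' *s E + k' *s H + f' *s F + a" and a: "a \<in> perp"
      by (rule decompose)
    have "br a E = 0" "br a F = 0" "br a H = 0"
      using triv[OF a] trivF[OF a] br_skew[of a] by (simp_all add: br_H br_linear)
    then have "br A B = (2 * (k' * e - e' * k)) *s E + (e' * f - f' * e) *s H
        + (2 * (f' * k - k' * f)) *s F"
      by (simp add: A B br_linear triple_br vec_eq_iff algebra_simps)
    then show ?thesis using S_I by metis
  qed
  ultimately have "S = {0} \<or> S = UNIV" using simple by (simp add: simple_lie_algebra_def)
  moreover have "E \<in> S" using S_I[of 1 0 0] by simp
  ultimately have "A \<in> S" using E_nonzero by auto
  then obtain e k f where A: "A = e *s E + k *s H + f *s F" by (auto simp: S_def)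
  have "coE A = e" "coH A = k" "coF A = f"
    using L_pos by (simp_all add: A coE_def coF_def coH_def ip_linear triple_ip)
  then show ?thesis using A by simp
qed

lemma spanning_imp_isomorphic_sl2:
  assumes span: "\<And>A. A = coE A *s E + coH A *s H + coF A *s F"
  shows "isomorphic_sl2 br"
proof -
  \<comment> \<open>The matrix with diagonal \<open>coH A\<close>, \<open>- coH A\<close> and
    off-diagonal entries \<open>coE A\<close>, \<open>coF A\<close>.\<close>
  define \<phi> :: "complex ^ 'n \<Rightarrow> complex ^ 2 ^ 2" where
    "\<phi> A = (\<chi> i j. if i = 1 then (if j = 1 then coH A else coE A)
                  else (if j = 1 then coF A else - coH A))" for A
  have co: "coE (e *s E + k *s H + f *s F) = e" "coH (e *s E + k *s H + f *s F) = k"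
    "coF (e *s E + k *s H + f *s F) = f" for e k f
    using L_pos by (simp_all add: coE_def coF_def coH_def ip_linear triple_ip)
  have \<phi>: "\<phi> A $ 1 $ 1 = coH A" "\<phi> A $ 1 $ 2 = coE A" "\<phi> A $ 2 $ 1 = coF A" "\<phi> A $ 2 $ 2 = - coH A" for A
    by (simp_all add: \<phi>_def)
  have \<phi>_cong: "\<phi> A = N \<longleftrightarrow> coH A = N $ 1 $ 1 \<and> coE A = N $ 1 $ 2 \<and> coF A = N $ 2 $ 1 \<and> - coH A = N $ 2 $ 2" for A N
    by (auto simp: vec_eq_iff forall_2 \<phi>)
  have "\<phi> (A + B) = \<phi> A + \<phi> B" for A B
    by (simp add: \<phi>_cong \<phi> coE_def coF_def coH_def ip_linear add_divide_distrib diff_divide_distrib)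
  moreover have "\<phi> (c *s A) = mat c ** \<phi> A" for c A
    by (simp add: \<phi>_cong \<phi> coE_def coF_def coH_def ip_linear add_divide_distrib diff_divide_distrib matrix_matrix_mult_def sum_2 mat_def)
  moreover have "bij_betw \<phi> UNIV {M. trace M = 0}"
    unfolding bij_betw_def
  proof
    show "inj \<phi>" by (rule injI) (metis \<phi> span)
    show "range \<phi> = {M. trace M = 0}"
    proof (intro set_eqI iffI)
      fix M :: "complex ^ 2 ^ 2" assume "M \<in> {M. trace M = 0}"
      then have "M = \<phi> ((M $ 1 $ 2) *s E + (M $ 1 $ 1) *s H + (M $ 2 $ 1) *s F)"
        by (subst eq_commute, subst \<phi>_cong, unfold co) (simp add: trace_def sum_2 minus_unique)
      then show "M \<in> range \<phi>" by blast
    qed (auto simp: trace_def sum_2 \<phi>)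
  qed
  moreover have "\<phi> (br A B) = \<phi> A ** \<phi> B - \<phi> B ** \<phi> A" for A B
  proof -
    have "br A B = br (coE A *s E + coH A *s H + coF A *s F) (coE B *s E + coH B *s H + coF B *s F)"
      using span[of A] span[of B] by simp
    also have "\<dots> = (2 * (coH A * coE B - coE A * coH B)) *s E + (coE A * coF B - coF A * coE B) *s H
        + (2 * (coF A * coH B - coH A * coF B)) *s F"
      by (simp add: br_linear triple_br vec_eq_iff algebra_simps)
    finally show ?thesis
      by (simp only: \<phi>_cong co) (simp add: \<phi> matrix_matrix_mult_def sum_2 algebra_simps)
  qed
  ultimately show ?thesis unfolding isomorphic_sl2_def by blast
qed

text \<open>Here the exclusion of \<open>sl(2)\<close> is used: \<open>br E a\<close> is the
  weight-one vector on which \<open>J\<close> is tested later.\<close>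

lemma exists_perp:
  assumes "simple_lie_algebra br" "\<not> isomorphic_sl2 br"
  obtains a where "a \<in> perp" "br E a \<noteq> 0"
  using perp_trivial_imp_spanning[OF assms(1)] spanning_imp_isomorphic_sl2 assms(2) by blast

end

section \<open>From a Cartan basis to a minimal vector\<close>

context compact_structure
begin

text \<open>Skewness of \<open>br x\<close> multiplies the pairing by
  \<open>\<mu> x + \<nu> x\<close> and gives zero.\<close>

lemma ip_root_spaces:
  assumes "y \<in> root_space br h \<mu>" "z \<in> root_space br h \<nu>" "x \<in> h" "\<mu> x + \<nu> x \<noteq> 0"
  shows "ip br y z = 0"
proof -
  have "ip br (br x y) z = - ip br y (br x z)" by (rule ip_ad_skew)
  then have "(\<mu> x + \<nu> x) * ip br y z = 0"
    using assms(1-3) by (simp add: root_space_def ip_linear algebra_simps)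
  then show ?thesis using assms(4) by simp
qed

lemma span_gen_ip:
  assumes "vec.span G = UNIV" "\<And>z. z \<in> G \<Longrightarrow> ip br y z = 0"
  shows "y = 0"
proof (rule ip_nondegenerate)
  fix B
  have "B \<in> vec.span G" using assms(1) by simp
  then show "ip br y B = 0"
    by (induction rule: vec.span_induct_alt) (simp_all add: ip_linear assms(2))
qed

end

locale cartan_data = compact_structure br \<sigma> for br :: "('n::finite) bracket" and \<sigma> +
  fixes h P E H F
  assumes pos: "positive_system br h P" and cb: "cartan_basis br h P E H F"
    and comp: "sigma_compatible \<sigma> P E H F"
begin

lemma
  assumes "\<beta> \<in> P"
  shows E_root: "E \<beta> \<in> root_space br h \<beta>" and F_root: "F \<beta> \<in> root_space br h (\<lambda>x. - \<beta> x)"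
    and H_h: "H \<beta> \<in> h" and EF: "br (E \<beta>) (F \<beta>) = H \<beta>" and HE: "br (H \<beta>) (E \<beta>) = 2 *s E \<beta>"
    and \<sigma>E: "\<sigma> (E \<beta>) = - F \<beta>"
    and outside: "x \<notin> h \<Longrightarrow> \<beta> x = 0" and root_nonzero: "\<exists>x\<in>h. \<beta> x \<noteq> 0"
    and root_space_nontrivial: "root_space br h \<beta> \<noteq> {0}"
proof -
  show "E \<beta> \<in> root_space br h \<beta>" "F \<beta> \<in> root_space br h (\<lambda>x. - \<beta> x)" "H \<beta> \<in> h"
    "br (E \<beta>) (F \<beta>) = H \<beta>" "br (H \<beta>) (E \<beta>) = 2 *s E \<beta>"
    using assms cb by (simp_all add: cartan_basis_def)
  show "\<sigma> (E \<beta>) = - F \<beta>" using assms comp by (simp add: sigma_compatible_def)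
  have "\<beta> \<in> roots br h" using assms pos by (auto simp: positive_system_def)
  then show "x \<notin> h \<Longrightarrow> \<beta> x = 0" "\<exists>x\<in>h. \<beta> x \<noteq> 0" "root_space br h \<beta> \<noteq> {0}"
    by (simp_all add: roots_def)
qed

lemma not_neg: "\<beta> \<in> P \<Longrightarrow> \<gamma> \<in> P \<Longrightarrow> \<beta> \<noteq> (\<lambda>x. - \<gamma> x)"
  using pos by (fastforce simp: positive_system_def)

lemma span_UNIV: "vec.span (E ` P \<union> H ` P \<union> F ` P) = UNIV"
  using cb by (simp add: cartan_basis_def)

lemma H_weight_0: assumes "\<beta> \<in> P" shows "H \<beta> \<in> root_space br h (\<lambda>_. 0)"
proof -
  have "br x (H \<beta>) = 0" if "x \<in> h" for x
  proof -
    have "br x (br (E \<beta>) (F \<beta>)) = br (br x (E \<beta>)) (F \<beta>) + br (E \<beta>) (br x (F \<beta>))"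
      by (simp add: jacobi)
    moreover have "br x (E \<beta>) = \<beta> x *s E \<beta>" "br x (F \<beta>) = - \<beta> x *s F \<beta>"
      using that E_root[OF assms] F_root[OF assms] by (simp_all add: root_space_def)
    ultimately show ?thesis
      by (simp add: EF[OF assms] br_linear)
  qed
  then show ?thesis by (simp add: root_space_def)
qed

text \<open>A vector of weight \<open>\<mu>\<close> is orthogonal to all generators of weight other
  than \<open>- \<mu>\<close>, in particular to every \<open>H \<beta>\<close>. The last two
  hypotheses treat the generators of weight exactly \<open>- \<mu>\<close>, and the generators
  span.\<close>

lemma weight_vector_eq_0:
  assumes y: "y \<in> root_space br h \<mu>" and out: "\<And>x. x \<notin> h \<Longrightarrow> \<mu> x = 0" and nz: "\<exists>x\<in>h. \<mu> x \<noteq> 0"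
    and 1: "\<And>\<beta>. \<beta> \<in> P \<Longrightarrow> \<mu> = \<beta> \<Longrightarrow> ip br y (F \<beta>) = 0"
    and 2: "\<And>\<beta>. \<beta> \<in> P \<Longrightarrow> \<mu> = (\<lambda>x. - \<beta> x) \<Longrightarrow> ip br y (E \<beta>) = 0"
  shows "y = 0"
proof (rule span_gen_ip[OF span_UNIV])
  have "ip br y (E \<beta>) = 0" if b: "\<beta> \<in> P" for \<beta>
  proof (cases "\<exists>x\<in>h. \<mu> x + \<beta> x \<noteq> 0")
    case True
    then show ?thesis using ip_root_spaces[OF y E_root[OF b]] by blast
  next
    case False
    then have "\<mu> = (\<lambda>x. - \<beta> x)"
      using out outside[OF b] by (metis add.inverse_neutral add_eq_0_iff2)
    then show ?thesis using 2[OF b] by simp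
  qed
  moreover have "ip br y (F \<beta>) = 0" if b: "\<beta> \<in> P" for \<beta>
  proof (cases "\<exists>x\<in>h. \<mu> x + - \<beta> x \<noteq> 0")
    case True
    then show ?thesis using ip_root_spaces[OF y F_root[OF b]] by blast
  next
    case False
    then have "\<mu> x = \<beta> x" for x
      using out[of x] outside[OF b, of x] by (cases "x \<in> h") auto
    then show ?thesis using 1[OF b] by blast
  qed
  moreover have "ip br y (H \<beta>) = 0" if b: "\<beta> \<in> P" for \<beta>
    using ip_root_spaces[OF y H_weight_0[OF b]] nz by auto
  ultimately show "ip br y z = 0" if "z \<in> E ` P \<union> H ` P \<union> F ` P" for z
    using that by blast
qed

lemma F_eq: "\<beta> \<in> P \<Longrightarrow> F \<beta> = - \<sigma> (E \<beta>)"
  by (simp add: \<sigma>E)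

text \<open>The triple relations alone admit the zero triple. In that case the whole root space of
  \<open>\<beta>\<close> would be orthogonal to all generators, so \<open>\<beta>\<close> would not
  be a root.\<close>

lemma E_nonzero: assumes b: "\<beta> \<in> P" shows "E \<beta> \<noteq> 0"
proof
  assume "E \<beta> = 0"
  then have F: "F \<beta> = 0" by (simp add: F_eq b)
  have "y = 0" if "y \<in> root_space br h \<beta>" for y
    by (rule weight_vector_eq_0[OF that outside[OF b] root_nonzero[OF b]])
      (use F not_neg[OF b] in auto)
  moreover have "0 \<in> root_space br h \<beta>" by (simp add: root_space_def br_linear)
  ultimately show False using root_space_nontrivial[OF b] by blast
qed

lemma ip_EF: "\<beta> \<in> P \<Longrightarrow> ip br (E \<beta>) (F \<beta>) = - complex_of_real (eta br \<sigma> (E \<beta>))"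
  by (simp add: F_eq ip_linear ip_eta)

text \<open>Twofold bracketing with \<open>E \<alpha>\<close> kills every generator except
  \<open>F \<alpha>\<close>, which it sends to \<open>- 2 *s E \<alpha>\<close>. The image is thus a
  line, and pairing with \<open>F \<alpha>\<close> identifies the coefficient.\<close>

lemma highest_root_minimal:
  assumes high: "highest_root br P E \<alpha>"
  shows "minimal_vector (2 / complex_of_real (eta br \<sigma> (E \<alpha>))) (E \<alpha>)"
proof -
  have a: "\<alpha> \<in> P" and EE: "\<And>\<beta>. \<beta> \<in> P \<Longrightarrow> br (E \<alpha>) (E \<beta>) = 0"
    using high by (auto simp: highest_root_def)
  have EH: "br (E \<alpha>) (H \<alpha>) = - 2 *s E \<alpha>"
    using br_skew[of "E \<alpha>" "H \<alpha>"] HE[OF a] by (simp add: vec_eq_iff)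
  have EEF: "br (E \<alpha>) (br (E \<alpha>) (F \<beta>)) = 0" if b: "\<beta> \<in> P" and ne: "\<beta> \<noteq> \<alpha>" for \<beta>
  proof -
    define y where "y = br (E \<alpha>) (F \<beta>)"
    define \<mu> where "\<mu> = (\<lambda>x. \<alpha> x - \<beta> x)"
    have y: "y \<in> root_space br h \<mu>"
    proof -
      have "br x y = \<mu> x *s y" if "x \<in> h" for x
      proof -
        have "br x y = br (br x (E \<alpha>)) (F \<beta>) + br (E \<alpha>) (br x (F \<beta>))"
          by (simp add: jacobi y_def)
        moreover have "br x (E \<alpha>) = \<alpha> x *s E \<alpha>" "br x (F \<beta>) = - \<beta> x *s F \<beta>"
          using that E_root[OF a] F_root[OF b] by (simp_all add: root_space_def)
        ultimately show ?thesis
          by (simp add: br_linear y_def[symmetric])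
            (simp add: \<mu>_def vec_eq_iff algebra_simps)
      qed
      then show ?thesis by (simp add: root_space_def)
    qed
    have out: "\<mu> x = 0" if "x \<notin> h" for x
      using that outside[OF a] outside[OF b] by (simp add: \<mu>_def)
    \<comment> \<open>Roots vanish outside \<open>h\<close>, so agreement of \<open>\<alpha>\<close>
      and \<open>\<beta>\<close> on \<open>h\<close> would force equality.\<close>
    have nz: "\<exists>x\<in>h. \<mu> x \<noteq> 0"
    proof (rule ccontr)
      assume "\<not> ?thesis"
      then have "\<mu> x = 0" for x using out by blast
      then show False using ne by (simp add: \<mu>_def fun_eq_iff)
    qed
    \<comment> \<open>Root spaces are lines, so \<open>y\<close> is a multiple of some \<open>E \<mu>\<close>, which commutes with \<open>E \<alpha>\<close>. If
      \<open>\<mu>\<close> is not positive, \<open>y\<close> could only pair with \<open>E \<gamma>\<close> for \<open>\<gamma> = - \<mu>\<close>, and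
      \<open>\<langle>y, E \<gamma>\<rangle> = - \<langle>F \<beta>, [E \<alpha>, E \<gamma>]\<rangle> = 0\<close>.\<close>
    show ?thesis
    proof (cases "\<mu> \<in> P")
      case True
      define c where "c = ip br y (F \<mu>) / ip br (E \<mu>) (F \<mu>)"
      have "ip br (E \<mu>) (F \<mu>) \<noteq> 0"
        using eta_pos[OF E_nonzero[OF True]] by (simp add: ip_EF True)
      then have F0: "ip br (y - c *s E \<mu>) (F \<mu>) = 0" by (simp add: c_def ip_linear)
      have "y - c *s E \<mu> \<in> root_space br h \<mu>"
        using y E_root[OF True] by (simp add: root_space_def br_linear vec_eq_iff algebra_simps)
      then have "y - c *s E \<mu> = 0"
        by (rule weight_vector_eq_0[OF _ out nz]) (use F0 not_neg[OF True] in auto)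
      then have "y = c *s E \<mu>" by simp
      then show ?thesis unfolding y_def[symmetric] using EE[OF True] by (simp add: br_linear)
    next
      case False
      have "y = 0"
      proof (rule weight_vector_eq_0[OF y out nz])
        fix \<gamma> assume "\<gamma> \<in> P"
        then show "ip br y (E \<gamma>) = 0"
          unfolding y_def by (simp add: ip_ad_skew EE)
      qed (use False in auto)
      then show ?thesis by (simp add: y_def[symmetric] br_linear)
    qed
  qed
  have "\<exists>k. br (E \<alpha>) (br (E \<alpha>) A) = k *s E \<alpha>" for A
  proof -
    have gen: "\<exists>k. br (E \<alpha>) (br (E \<alpha>) z) = k *s E \<alpha>" if z: "z \<in> E ` P \<union> H ` P \<union> F ` P" for z
    proof -
      consider \<beta> where "\<beta> \<in> P" "z = E \<beta>" | \<beta> where "\<beta> \<in> P" "z = H \<beta>"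
        | "z = F \<alpha>" | \<beta> where "\<beta> \<in> P" "\<beta> \<noteq> \<alpha>" "z = F \<beta>" using z by blast
      then show ?thesis
      proof cases
        case 1
        then show ?thesis using EE by (auto simp: br_linear intro: exI[of _ 0])
      next
        case 2
        have "br (E \<alpha>) (H \<beta>) = - (\<alpha> (H \<beta>) *s E \<alpha>)"
          using E_root[OF a] H_h[OF 2(1)] br_skew[of "E \<alpha>" "H \<beta>"] by (simp add: root_space_def)
        then show ?thesis using 2 by (auto simp: br_linear intro: exI[of _ 0])
      next
        case 3
        then have "br (E \<alpha>) (br (E \<alpha>) z) = - 2 *s E \<alpha>" by (simp only: EF[OF a] EH)
        then show ?thesis by blast
      next
        case 4
        then show ?thesis using EEF by (auto intro: exI[of _ 0])
      qed
    qed
    have "A \<in> vec.span (E ` P \<union> H ` P \<union> F ` P)" by (simp add: span_UNIV)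
    then show ?thesis
    proof (induction rule: vec.span_induct_alt)
      case base
      then show ?case by (auto simp: br_linear intro: exI[of _ 0])
    next
      case (step c x y)
      obtain k1 k2 where "br (E \<alpha>) (br (E \<alpha>) x) = k1 *s E \<alpha>" "br (E \<alpha>) (br (E \<alpha>) y) = k2 *s E \<alpha>"
        using gen[OF step(1)] step(2) by blast
      then have "br (E \<alpha>) (br (E \<alpha>) (c *s x + y)) = (c * k1 + k2) *s E \<alpha>"
        by (simp add: br_linear vec_eq_iff algebra_simps)
      then show ?case by blast
    qed
  qed
  then obtain k where k: "\<And>A. br (E \<alpha>) (br (E \<alpha>) A) = k A *s E \<alpha>" by metis
  define L where "L = eta br \<sigma> (E \<alpha>)"
  have L: "L > 0" unfolding L_def by (rule eta_pos[OF E_nonzero[OF a]])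
  have "k A = 2 / L * ip br (E \<alpha>) A" for A
  proof -
    have "ip br (br (E \<alpha>) (br (E \<alpha>) A)) (F \<alpha>) = ip br A (br (E \<alpha>) (br (E \<alpha>) (F \<alpha>)))"
      by (simp add: ip_ad_skew)
    then have "k A * - complex_of_real L = - 2 * ip br (E \<alpha>) A"
      unfolding k[of A] EF[OF a] EH ip_linear ip_EF[OF a] L_def[symmetric] ip_sym[of A] .
    then show ?thesis using L by (simp add: field_simps)
  qed
  then show ?thesis unfolding minimal_vector_def L_def[symmetric] by (simp add: k)
qed

end

section \<open>Invariant potentials on minimal orbits\<close>

lemma Ck_on_const: "Ck_on k U (\<lambda>_. c)"
  by (induction k arbitrary: c) auto

lemma Ck_on_bounded_linear:
  assumes "bounded_linear f" shows "Ck_on k U f"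
proof (cases k)
  case 0
  then show ?thesis using assms by (simp add: linear_continuous_on)
next
  case (Suc k)
  have "frechet_derivative f (at x) = f" for x
    using frechet_derivative_at[OF bounded_linear_imp_has_derivative[OF assms, of "at x"]] by simp
  then show ?thesis
    using assms Suc by (simp add: Ck_on_const bounded_linear_imp_differentiable)
qed

lemma smooth_fun_bounded_linear:
  assumes "bounded_linear f" shows "smooth_fun M f"
  unfolding smooth_fun_def using Ck_on_bounded_linear[OF assms] by (blast intro: open_UNIV)

text \<open>Smoothness on \<open>M\<close> is defined by local extensions; this transfers their
  ambient derivatives to derivatives within \<open>M\<close>.\<close>

lemma has_derivative_within_extension:
  assumes "open U" "x \<in> U" "x \<in> M" "\<And>y. y \<in> U \<inter> M \<Longrightarrow> f y = f' y"
    and "(f' has_derivative D) (at x)"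
  shows "(f has_derivative D) (at x within M)"
proof -
  obtain d where "d > 0" and d: "ball x d \<subseteq> U"
    using assms(1,2) open_contains_ball by blast
  have "(f' has_derivative D) (at x within M)"
    using assms(5) by (rule has_derivative_at_withinI)
  then show ?thesis
    using \<open>d > 0\<close> assms(3)
    by (rule has_derivative_transform_within)
      (use assms(4) d in \<open>auto simp: dist_commute subset_iff\<close>)
qed

lemma smooth_fun_differentiable:
  assumes "smooth_fun M f" "x \<in> M"
  shows "f differentiable (at x within M)"
proof -
  obtain U f' where U: "open U" "x \<in> U" "\<forall>k. Ck_on k U f'" "\<forall>y\<in>U \<inter> M. f y = f' y"
    using assms unfolding smooth_fun_def by blast
  then have "Ck_on (Suc 0) U f'" by blast
  then have "f' differentiable (at x)" using U(2) by simp
  then obtain D where "(f' has_derivative D) (at x)" unfolding differentiable_def by blast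
  then have "(f has_derivative D) (at x within M)"
    using has_derivative_within_extension[OF U(1,2) assms(2)] U(4) by blast
  then show ?thesis unfolding differentiable_def by blast
qed

section \<open>Calculus along exponential curves\<close>

locale invariant_set = compact_structure br \<sigma> for br :: "('n::finite) bracket" and \<sigma> +
  fixes M :: "(complex ^ 'n) set"
  assumes exp_ad_mem: "X \<in> M \<Longrightarrow> exp_ad br A X \<in> M"
begin

text \<open>The curve stays in \<open>M\<close> and has velocity \<open>br A X\<close> at
  \<open>0\<close>, so the chain rule applies to a derivative within \<open>M\<close>.\<close>

lemma has_vector_derivative_along_orbit:
  assumes "(f has_derivative f') (at X within M)" "X \<in> M"
  shows "((\<lambda>t. f (exp_ad br (t *\<^sub>R A) X)) has_vector_derivative f' (br A X)) (at 0)"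
proof -
  let ?c = "\<lambda>t. exp_ad br (t *\<^sub>R A) X"
  have c: "(?c has_derivative (\<lambda>r. r *\<^sub>R br A X)) (at 0)"
    using exp_ad_has_vector_derivative[of A X 0] by (simp add: has_vector_derivative_def)
  have "(f has_derivative f') (at (?c 0) within range ?c)"
    by (rule has_derivative_subset[of _ _ _ M]) (use assms exp_ad_mem in auto)
  then have "((\<lambda>t. f (?c t)) has_derivative (\<lambda>r. f' (r *\<^sub>R br A X))) (at 0)"
    by (rule has_derivative_in_compose[OF c])
  moreover have "f' (r *\<^sub>R br A X) = r *\<^sub>R f' (br A X)" for r
    using linear_scale[OF has_derivative_linear[OF assms(1)]] .
  ultimately show ?thesis by (simp add: has_vector_derivative_def)
qed

text \<open>\<open>dir_deriv\<close> rests on a chosen derivative within \<open>M\<close>. On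
  \<open>br A X\<close> any two candidates compute the velocity of the same curve.\<close>

lemma dir_deriv_eq:
  assumes "(f has_derivative f') (at X within M)" "X \<in> M"
  shows "dir_deriv M f X (br A X) = f' (br A X)"
proof -
  have "(f has_derivative frechet_derivative f (at X within M)) (at X within M)"
    using assms(1) by (auto simp: differentiable_def frechet_derivative_works[symmetric])
  from has_vector_derivative_along_orbit[OF this assms(2)]
    has_vector_derivative_along_orbit[OF assms] show ?thesis
    unfolding dir_deriv_def by (rule vector_derivative_unique_at)
qed

lemma smooth_vfield_br: "smooth_vfield M (orbit_tangent br) (br A)"
  unfolding smooth_vfield_def orbit_tangent_def
  using smooth_fun_bounded_linear[OF br.bounded_linear_right] by blast

text \<open>The fields are linear, so their bracket is a commutator of \<open>br A\<close> and
  \<open>br B\<close>, in reversed order.\<close>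

lemma vf_bracket_br:
  assumes "X \<in> M" shows "vf_bracket M (br A) (br B) X = br (br B A) X"
proof -
  have "dir_deriv M (br A) X (br B X) = br A (br B X)" for A B
    by (rule dir_deriv_eq[OF _ assms])
      (rule bounded_linear.has_derivative[OF br.bounded_linear_right has_derivative_ident])
  then show ?thesis by (simp add: vf_bracket_def jacobi)
qed

text \<open>Near \<open>X\<close> the chosen derivatives can be replaced by those of one smooth
  extension, because \<open>y\<close> is tangent at \<open>y\<close>. Expansion in a basis then
  reduces the claim to second derivatives of the extension.\<close>

lemma dir_deriv_radial_differentiable:
  assumes f: "smooth_fun M (f :: _ \<Rightarrow> real)" and X: "X \<in> M"
    and tangent: "\<And>y. y \<in> M \<Longrightarrow> y \<in> orbit_tangent br y"
  shows "(\<lambda>y. dir_deriv M f y y) differentiable (at X within M)"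
proof -
  obtain U f' where U: "open U" "X \<in> U" "\<forall>k. Ck_on k U f'" "\<forall>y\<in>U \<inter> M. f y = f' y"
    using f X unfolding smooth_fun_def by blast
  have "Ck_on (Suc (Suc 0)) U f'" using U(3) by blast
  then have d1: "\<And>y. y \<in> U \<Longrightarrow> f' differentiable (at y)"
    and d2: "\<And>y v. y \<in> U \<Longrightarrow> (\<lambda>z. frechet_derivative f' (at z) v) differentiable (at y)"
    by simp_all
  let ?g = "\<lambda>y. \<Sum>b\<in>Basis. (y \<bullet> b) * frechet_derivative f' (at y) b"
  have eq: "dir_deriv M f y y = ?g y" if y: "y \<in> U \<inter> M" for y
  proof -
    have D: "(f' has_derivative frechet_derivative f' (at y)) (at y)"
      using d1 y frechet_derivative_works by blast
    then have "(f has_derivative frechet_derivative f' (at y)) (at y within M)"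
      using has_derivative_within_extension[of U y M f f'] U y by blast
    moreover obtain A where "y = br A y"
      using tangent[of y] y unfolding orbit_tangent_def by blast
    ultimately have "dir_deriv M f y y = frechet_derivative f' (at y) y"
      using dir_deriv_eq y by (metis IntD2)
    also have "\<dots> = frechet_derivative f' (at y) (\<Sum>b\<in>Basis. (y \<bullet> b) *\<^sub>R b)"
      by (simp add: euclidean_representation)
    also have "\<dots> = ?g y"
      using has_derivative_linear[OF D] by (simp add: linear_sum linear_scale)
    finally show ?thesis .
  qed
  have "?g differentiable (at X)"
    using d2[OF U(2)]
    by (intro differentiable_sum differentiable_mult finite_Basis ballI)
      (auto intro: bounded_linear_imp_differentiable bounded_linear_inner_left)
  then obtain D where "(?g has_derivative D) (at X)" unfolding differentiable_def by blast
  then have "((\<lambda>y. dir_deriv M f y y) has_derivative D) (at X within M)"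
    using has_derivative_within_extension[OF U(1,2) X, of "\<lambda>y. dir_deriv M f y y" ?g D] eq by blast
  then show ?thesis unfolding differentiable_def by blast
qed

end

section \<open>Invariant functions on sets of minimal vectors\<close>

lemma (in compact_structure) \<sigma>_exp_ad: "\<sigma> (exp_ad br A X) = exp_ad br (\<sigma> A) (\<sigma> X)"
proof -
  have "\<sigma> ((br A ^^ k) X) = (br (\<sigma> A) ^^ k) (\<sigma> X)" for k
    by (induction k) (simp_all add: \<sigma>_br)
  then show ?thesis
    using bounded_linear.sums[OF bounded_linear_\<sigma> exp_ad_sums[of A X]] exp_ad_sums[of "\<sigma> A" "\<sigma> X"]
    by (simp add: linear_scale[OF linear_\<sigma>] sums_unique2)
qed

lemma (in compact_structure) eta_exp_ad: "\<sigma> B = B \<Longrightarrow> eta br \<sigma> (exp_ad br B X) = eta br \<sigma> X"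
  by (simp add: eta_def \<sigma>_exp_ad ip_exp_ad)

text \<open>Infinitesimal invariance of \<open>eta\<close>: conjugation moves \<open>br B\<close> to
  the other argument and skewness adds a sign, so the pairing is imaginary.\<close>

lemma (in compact_structure) Re_ip_real_tangent:
  assumes "\<sigma> B = B" shows "Re (ip br (br B X) (\<sigma> X)) = 0"
proof -
  have "cnj (ip br (br B X) (\<sigma> X)) = ip br (br B (\<sigma> X)) X"
    using ip_\<sigma>[of "br B X" "\<sigma> X"] by (simp add: \<sigma>_br assms)
  also have "\<dots> = - ip br (br B X) (\<sigma> X)"
    by (simp add: ip_ad_skew ip_sym[of "\<sigma> X"])
  finally show ?thesis by (simp add: complex_eq_iff)
qed

lemma (in complex_lie_algebra) minimal_vector_scale:
  "minimal_vector c X \<Longrightarrow> minimal_vector c (k *s X)"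
  by (simp add: minimal_vector_def br_linear ip_linear vec_eq_iff)

locale minimal_orbit = invariant_set br \<sigma> M
  for br :: "('n::finite) bracket" and \<sigma> and M +
  fixes L :: real
  assumes L_pos: "L > 0"
    and nonzero: "X \<in> M \<Longrightarrow> X \<noteq> 0"
    and minimal: "X \<in> M \<Longrightarrow> minimal_vector (2 / complex_of_real L) X"
begin

text \<open>Rescale \<open>X\<close> to make \<open>eta\<close> equal to \<open>L\<close>; the
  minimality identity is homogeneous of degree two in \<open>X\<close>.\<close>

lemma triple:
  assumes "X \<in> M"
  obtains t E where "t > 0" "X = t *\<^sub>R E" "eta br \<sigma> X = t\<^sup>2 * L" "minimal_triple br \<sigma> L E"
proof -
  define t where "t = sqrt (eta br \<sigma> X / L)"
  have eta: "eta br \<sigma> X > 0" by (rule eta_pos[OF nonzero[OF assms]])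
  then have t: "t > 0" and t2: "t\<^sup>2 * L = eta br \<sigma> X" using L_pos by (simp_all add: t_def)
  define E where "E = (1 / t) *\<^sub>R X"
  have X: "X = t *\<^sub>R E" using t by (simp add: E_def)
  have "minimal_triple br \<sigma> L E"
  proof
    show "E \<noteq> 0" using nonzero[OF assms] X by auto
    show "eta br \<sigma> E = L"
      using t by (simp add: E_def eta_scaleR t2[symmetric] power_divide)
    show "minimal_vector (2 / complex_of_real L) E"
      unfolding E_def scaleR_eq_of_real by (rule minimal_vector_scale[OF minimal[OF assms]])
  qed
  then show ?thesis using that[OF t X t2[symmetric]] by blast
qed

text \<open>Half of \<open>H\<close> acts on \<open>E\<close>, and hence on \<open>X\<close>, as the
  identity.\<close>

lemma radial_tangent: assumes "X \<in> M" shows "X \<in> orbit_tangent br X"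
proof -
  obtain t E where X: "X = t *\<^sub>R E" and "minimal_triple br \<sigma> L E" using triple[OF assms] .
  then interpret T: minimal_triple br \<sigma> L E by simp
  have "X = br ((1/2) *s T.H) X"
    by (simp add: X br_linear T.br_HE br.scaleR_right vec_eq_iff)
  then show ?thesis unfolding orbit_tangent_def by blast
qed

lemma real_tangent_decomposition:
  assumes "X \<in> M"
  obtains B r where "\<sigma> B = B" "br A X = br B X + r *\<^sub>R X"
proof -
  obtain t E where X: "X = t *\<^sub>R E" and "minimal_triple br \<sigma> L E" using triple[OF assms] .
  then interpret T: minimal_triple br \<sigma> L E by simp
  obtain B r where "\<sigma> B = B" "br A E = br B E + r *\<^sub>R E" by (rule T.tangent_decomposition)
  then show ?thesis
    by (intro that[of B r]) (simp_all add: X br.scaleR_right scaleR_add_right)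
qed

text \<open>Only the radial part \<open>r *\<^sub>R X\<close> of the tangent vector contributes, and
  the real part of the pairing with \<open>\<sigma> X\<close> recovers \<open>r\<close>.\<close>

lemma invariant_derivative:
  fixes f :: "complex ^ 'n \<Rightarrow> real"
  assumes X: "X \<in> M" and f: "(f has_derivative f') (at X within M)"
    and inv: "\<And>B. \<sigma> B = B \<Longrightarrow> f (exp_ad br B X) = f X"
  shows "f' (br A X) = f' X / eta br \<sigma> X * Re (ip br (br A X) (\<sigma> X))"
proof -
  obtain B r where B: "\<sigma> B = B" "br A X = br B X + r *\<^sub>R X"
    by (rule real_tangent_decomposition[OF X])
  have "\<sigma> (t *\<^sub>R B) = t *\<^sub>R B" for t
    using B(1) by (simp add: linear_scale[OF linear_\<sigma>])
  then have "((\<lambda>t. f (exp_ad br (t *\<^sub>R B) X)) has_vector_derivative 0) (at 0)"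
    using inv by simp
  then have "f' (br B X) = 0"
    using has_vector_derivative_along_orbit[OF f X] vector_derivative_unique_at by blast
  then have "f' (br A X) = r * f' X"
    using has_derivative_linear[OF f] by (simp add: B(2) linear_add linear_scale)
  moreover have "Re (ip br (br A X) (\<sigma> X)) = r * eta br \<sigma> X"
    using Re_ip_real_tangent[OF B(1)] by (simp add: B(2) ip_linear scaleR_eq_of_real eta_def)
  ultimately show ?thesis using eta_pos[OF nonzero[OF X]] by simp
qed

end

section \<open>The metric in terms of the potential\<close>

locale invariant_potential = minimal_orbit br \<sigma> M L
  for br :: "('n::finite) bracket" and \<sigma> and M and L +
  fixes g :: "complex ^ 'n \<Rightarrow> complex ^ 'n \<Rightarrow> complex ^ 'n \<Rightarrow> real"
    and \<rho> :: "complex ^ 'n \<Rightarrow> real"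
  assumes potential: "kahler_potential M (orbit_tangent br) g orbit_I \<rho>"
    and G_inv: "G_invariant br \<sigma> M \<rho>"
begin

definition "N y = dir_deriv M \<rho> y y"

definition "m y = N y / eta br \<sigma> y"

lemma smooth_\<rho>: "smooth_fun M \<rho>"
  using potential by (simp add: kahler_potential_def)

lemma \<rho>_derivative:
  assumes "y \<in> M"
  shows "(\<rho> has_derivative frechet_derivative \<rho> (at y within M)) (at y within M)"
  using smooth_fun_differentiable[OF smooth_\<rho> assms] by (simp add: frechet_derivative_works[symmetric])

lemma \<rho>_inv: "\<sigma> B = B \<Longrightarrow> y \<in> M \<Longrightarrow> \<rho> (exp_ad br B y) = \<rho> y"
  using G_inv adjoint_group.step[OF _ adjoint_group.id, of B "{A. \<sigma> A = A}" br]
  by (auto simp: G_invariant_def)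

lemma dir_deriv_\<rho>:
  assumes y: "y \<in> M"
  shows "dir_deriv M \<rho> y (br A y) = m y * Re (ip br (br A y) (\<sigma> y))"
proof -
  obtain C where "y = br C y" using radial_tangent[OF y] by (auto simp: orbit_tangent_def)
  then have "frechet_derivative \<rho> (at y within M) y = N y"
    by (simp add: N_def dir_deriv_def)
  then show ?thesis
    using invariant_derivative[OF y \<rho>_derivative[OF y] \<rho>_inv[OF _ y]]
    unfolding dir_deriv_def m_def by simp
qed

text \<open>\<open>exp_ad br B\<close> is linear and preserves \<open>\<rho>\<close>, so the chain
  rule carries the radial derivative at \<open>X\<close> to that at the image point.\<close>

lemma N_inv:
  assumes B: "\<sigma> B = B" and X: "X \<in> M"
  shows "N (exp_ad br B X) = N X"
proof -
  let ?u = "exp_ad br B"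
  have uX: "?u X \<in> M" by (rule exp_ad_mem[OF X])
  define D where "D = frechet_derivative \<rho> (at (?u X) within M)"
  have D: "(\<rho> has_derivative D) (at (?u X) within M)"
    unfolding D_def by (rule \<rho>_derivative[OF uX])
  have u: "(?u has_derivative ?u) (at X within M)"
    using linear_exp_ad by (simp add: linear_conv_bounded_linear bounded_linear_imp_has_derivative)
  have "(\<rho> has_derivative D) (at (?u X) within ?u ` M)"
    by (rule has_derivative_subset[OF D]) (use exp_ad_mem in auto)
  then have "((\<lambda>y. \<rho> (?u y)) has_derivative (\<lambda>v. D (?u v))) (at X within M)"
    by (rule has_derivative_in_compose[OF u])
  then have *: "(\<rho> has_derivative (\<lambda>v. D (?u v))) (at X within M)"
    by (rule has_derivative_transform_within[OF _ zero_less_one X]) (simp add: \<rho>_inv[OF B])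
  obtain C where C: "X = br C X" using radial_tangent[OF X] by (auto simp: orbit_tangent_def)
  have "N X = D (?u X)" unfolding N_def using dir_deriv_eq[OF * X, of C] C by simp
  then show ?thesis by (simp add: N_def D_def dir_deriv_def)
qed

lemma m_inv: "\<sigma> B = B \<Longrightarrow> X \<in> M \<Longrightarrow> m (exp_ad br B X) = m X"
  by (simp add: m_def N_inv eta_exp_ad)

lemma eta_has_derivative:
  "(eta br \<sigma> has_derivative (\<lambda>v. Re (ip br X (\<sigma> v) + ip br v (\<sigma> X)))) (at X within M)"
  unfolding eta_def[abs_def]
  by (intro bounded_linear.has_derivative[OF bounded_linear_Re]
      bounded_bilinear.FDERIV[OF bounded_bilinear_ip]
      bounded_linear.has_derivative[OF bounded_linear_\<sigma>] has_derivative_ident)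

lemma m_differentiable: assumes X: "X \<in> M" shows "m differentiable (at X within M)"
  unfolding m_def[abs_def] N_def
proof (rule differentiable_divide)
  show "(\<lambda>y. dir_deriv M \<rho> y y) differentiable (at X within M)"
    by (rule dir_deriv_radial_differentiable[OF smooth_\<rho> X radial_tangent])
  show "eta br \<sigma> differentiable (at X within M)"
    using eta_has_derivative differentiable_def by blast
  show "eta br \<sigma> X \<noteq> 0" using eta_pos[OF nonzero[OF X]] by simp
qed

text \<open>On the tangent space at \<open>X\<close>, \<open>d\<rho> = (m / 2) d\<eta>\<close> and \<open>dm = q d\<eta>\<close>.\<close>

definition "q X = frechet_derivative m (at X within M) X / (2 * eta br \<sigma> X)"

lemma m_derivative:
  assumes X: "X \<in> M"
  obtains m' where "(m has_derivative m') (at X within M)"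
    "\<And>A. m' (br A X) = 2 * q X * Re (ip br (br A X) (\<sigma> X))"
proof -
  define m' where "m' = frechet_derivative m (at X within M)"
  have m': "(m has_derivative m') (at X within M)"
    using m_differentiable[OF X] by (simp add: m'_def frechet_derivative_works[symmetric])
  show ?thesis
    using invariant_derivative[OF X m' m_inv[OF _ X]]
    by (intro that[OF m']) (simp add: q_def m'_def)
qed

text \<open>The exterior derivative is evaluated on the fields \<open>br A\<close> and
  \<open>br B\<close>, which realise all tangent vectors and on which the one-form is
  \<open>m y * k C y\<close>.\<close>

lemma kahler_form_potential:
  assumes X: "X \<in> M" and u: "u \<in> orbit_tangent br X" and v: "v \<in> orbit_tangent br X"
  shows "kahler_form g orbit_I X u v =
    Im (m X * ip br u (\<sigma> v) + q X * ip br u (\<sigma> X) * cnj (ip br v (\<sigma> X)))"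
proof -
  obtain A B where u: "u = br A X" and v: "v = br B X" using u v by (auto simp: orbit_tangent_def)
  define \<theta> where "\<theta> = (\<lambda>y v. - dir_deriv M \<rho> y (orbit_I y v))"
  define k where "k C y = Im (ip br (br C y) (\<sigma> y))" for C y
  define k' where "k' C w = Im (ip br (br C X) (\<sigma> w) + ip br (br C w) (\<sigma> X))" for C w
  have \<theta>: "\<theta> y (br C y) = m y * k C y" if "y \<in> M" for y C
  proof -
    have "orbit_I y (br C y) = br (\<i> *s C) y" by (simp add: orbit_I_def br_linear)
    then have "\<theta> y (br C y) = - (m y * Re (ip br (br (\<i> *s C) y) (\<sigma> y)))"
      by (simp only: \<theta>_def dir_deriv_\<rho>[OF that])
    then show ?thesis by (simp add: k_def br_linear ip_linear)
  qed
  have k: "(k C has_derivative k' C) (at X within M)" for C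
    unfolding k_def[abs_def] k'_def[abs_def]
    by (intro bounded_linear.has_derivative[OF bounded_linear_Im]
        bounded_bilinear.FDERIV[OF bounded_bilinear_ip]
        bounded_linear.has_derivative[OF br.bounded_linear_right]
        bounded_linear.has_derivative[OF bounded_linear_\<sigma>] has_derivative_ident)
  obtain m' where m': "(m has_derivative m') (at X within M)"
    and m'_br: "\<And>A. m' (br A X) = 2 * q X * Re (ip br (br A X) (\<sigma> X))"
    using m_derivative[OF X] by blast
  have d\<theta>: "dir_deriv M (\<lambda>y. \<theta> y (br C y)) X (br D X) = m X * k' C (br D X) + m' (br D X) * k C X"
    for C D
  proof (rule dir_deriv_eq[OF _ X])
    have "((\<lambda>y. m y * k C y) has_derivative (\<lambda>w. m X * k' C w + m' w * k C X)) (at X within M)"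
      by (rule has_derivative_mult[OF m' k])
    then show "((\<lambda>y. \<theta> y (br C y)) has_derivative (\<lambda>w. m X * k' C w + m' w * k C X)) (at X within M)"
      by (rule has_derivative_transform_within[OF _ zero_less_one X]) (simp add: \<theta>)
  qed
  have "kahler_form g orbit_I X u v = - (1 / 2) * ext_deriv1 M \<theta> (br A) (br B) X"
    using potential smooth_vfield_br X unfolding kahler_potential_def \<theta>_def u v by blast
  also have "ext_deriv1 M \<theta> (br A) (br B) X =
      m X * k' B u + m' u * k B X - (m X * k' A v + m' v * k A X) - m X * k (br B A) X"
    unfolding ext_deriv1_def d\<theta> vf_bracket_br[OF X] \<theta>[OF X] u v ..
  \<comment> \<open>The terms with two nested brackets cancel against the bracket of the fields; the
    rest pairs up with its complex conjugate.\<close>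
  also have "\<dots> = - 2 * Im (m X * ip br u (\<sigma> v) + q X * ip br u (\<sigma> X) * cnj (ip br v (\<sigma> X)))"
  proof -
    have k_br: "k (br B A) X = Im (ip br (br B u) (\<sigma> X)) - Im (ip br (br A v) (\<sigma> X))"
      by (simp add: k_def jacobi ip_linear u v)
    moreover have "ip br v (\<sigma> u) = cnj (ip br u (\<sigma> v))"
      using ip_\<sigma>'[of u v] ip_sym by simp
    ultimately show ?thesis
      unfolding k_br unfolding u v m'_br k'_def k_def by (simp add: algebra_simps)
  qed
  finally show ?thesis by linarith
qed

text \<open>Putting \<open>- \<i> *s v\<close> in the second slot of the Kaehler form cancels
  \<open>orbit_I\<close> and leaves \<open>g\<close> itself.\<close>

lemma metric_potential:
  assumes X: "X \<in> M" and u: "u \<in> orbit_tangent br X" and v: "v \<in> orbit_tangent br X"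
  shows "g X u v = Re (m X * ip br u (\<sigma> v) + q X * ip br u (\<sigma> X) * cnj (ip br v (\<sigma> X)))"
    and "g X u (\<i> *s v) = Im (m X * ip br u (\<sigma> v) + q X * ip br u (\<sigma> X) * cnj (ip br v (\<sigma> X)))"
proof -
  obtain B where "v = br B X" using v by (auto simp: orbit_tangent_def)
  then have "- \<i> *s v = br (- \<i> *s B) X" by (simp only: br_linear)
  then have "- \<i> *s v \<in> orbit_tangent br X" by (auto simp: orbit_tangent_def)
  from kahler_form_potential[OF X u this] show
    "g X u v = Re (m X * ip br u (\<sigma> v) + q X * ip br u (\<sigma> X) * cnj (ip br v (\<sigma> X)))"
    by (simp add: kahler_form_def orbit_I_def \<sigma>_linear ip_linear algebra_simps)
  show "g X u (\<i> *s v) = Im (m X * ip br u (\<sigma> v) + q X * ip br u (\<sigma> X) * cnj (ip br v (\<sigma> X)))"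
    using kahler_form_potential[OF X u v] by (simp add: kahler_form_def orbit_I_def)
qed

end

section \<open>Determination of \<open>J\<close>\<close>

locale orbit_hyperkahler = invariant_potential br \<sigma> M L g \<rho>
  for br :: "('n::finite) bracket" and \<sigma> and M and L and g and \<rho> +
  fixes J K :: "complex ^ 'n \<Rightarrow> complex ^ 'n \<Rightarrow> complex ^ 'n"
  assumes hk: "hyperkahler M (orbit_tangent br) g orbit_I J K"
    and kks: "kks_compatible br M g J K"
begin

lemma
  assumes "X \<in> M" "v \<in> orbit_tangent br X"
  shows J_tangent: "J X v \<in> orbit_tangent br X" and J_J: "J X (J X v) = - v"
    and K_eq: "K X v = \<i> *s J X v" and g_pos: "v \<noteq> 0 \<Longrightarrow> g X v v > 0"
  using hk assms
  by (auto simp: hyperkahler_def kahler_def complex_structure_def almost_complex_structure_def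
      riemannian_metric_def orbit_I_def)

text \<open>Compatibility and nondegeneracy of \<open>ip\<close> give
  \<open>w = \<Phi> (J X w)\<close> on tangent vectors. Taking \<open>w = J X v\<close> and using
  that \<open>J\<close> squares to minus one yields \<open>J X v = - \<Phi> v\<close>.\<close>

lemma J_formula:
  assumes X: "X \<in> M" and v: "v \<in> orbit_tangent br X"
  shows "J X v = - (m X *\<^sub>R br X (\<sigma> v) + (q X * ip br (\<sigma> v) X) *s br X (\<sigma> X))"
proof -
  define \<Phi> where "\<Phi> w = m X *\<^sub>R br X (\<sigma> w) + (q X * ip br (\<sigma> w) X) *s br X (\<sigma> X)" for w
  have w_eq: "w = \<Phi> (J X w)" if w: "w \<in> orbit_tangent br X" for w
  proof (rule ip_cancel)
    fix A
    obtain B where B: "w = br B X" using w by (auto simp: orbit_tangent_def)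
    have A: "br A X \<in> orbit_tangent br X" by (auto simp: orbit_tangent_def)
    note metric = metric_potential[OF X A J_tangent[OF X w]]
    have "ip br A w = ip br X (br A B)"
      by (simp add: B ip_sym[of X] ip_invariant)
    \<comment> \<open>As \<open>K X w = \<i> *s J X w\<close>, the two Kaehler forms are the real
      and imaginary parts of one sesquilinear expression in \<open>br A X\<close> and
      \<open>J X w\<close>.\<close>
    also have "\<dots> = m X * ip br (br A X) (\<sigma> (J X w))
        + q X * ip br (br A X) (\<sigma> X) * cnj (ip br (J X w) (\<sigma> X))"
      using kks X unfolding kks_compatible_def kahler_form_def B[symmetric]
      by (auto simp: K_eq[OF X w] metric B[symmetric] complex_eq_iff)
    also have "\<dots> = ip br A (\<Phi> (J X w))"
      by (simp add: \<Phi>_def ip_invariant ip_linear scaleR_eq_of_real ip_\<sigma>')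
    finally show "ip br A w = ip br A (\<Phi> (J X w))" .
  qed
  have "J X v = \<Phi> (- v)"
    using w_eq[OF J_tangent[OF X v]] by (simp add: J_J[OF X v])
  also have "\<dots> = - \<Phi> v"
    by (simp add: \<Phi>_def \<sigma>_linear br_linear ip_linear)
  finally show ?thesis by (simp add: \<Phi>_def)
qed

lemma coefficients:
  assumes X: "X \<in> M" and X_eq: "X = t *\<^sub>R E" and t: "t > 0" and triple: "minimal_triple br \<sigma> L E"
    and simple: "simple_lie_algebra br" and not_sl2: "\<not> isomorphic_sl2 br"
  shows "m X = 1 / t" and "q X = - 1 / (2 * t ^ 3 * L)"
proof -
  interpret T: minimal_triple br \<sigma> L E by fact
  have \<sigma>X: "\<sigma> X = - t *\<^sub>R T.F" by (simp add: X_eq linear_scale[OF linear_\<sigma>] T.\<sigma>_E)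
  obtain a where a: "a \<in> T.perp" and "br E a \<noteq> 0" using T.exists_perp[OF simple not_sl2] .
  define v where "v = br E a"
  have v0: "v \<noteq> 0" and vp: "v \<in> T.perp" using \<open>br E a \<noteq> 0\<close> T.perp_br_E[OF a] by (simp_all add: v_def)
  have tangent: "br E b \<in> orbit_tangent br X" for b
    using br_skew[of E b] t
    by (auto simp: orbit_tangent_def X_eq br.scaleR_right br.scaleR_left br.minus_left
        intro!: image_eqI[of _ _ "(- 1 / t) *\<^sub>R b"])
  have vt: "v \<in> orbit_tangent br X" unfolding v_def by (rule tangent)
  \<comment> \<open>On \<open>perp\<close> the \<open>q\<close> term drops out, so these vectors
    isolate \<open>m X\<close>.\<close>
  have J_perp: "J X w = - (m X * t) *\<^sub>R br E (\<sigma> w)"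
    if "w \<in> T.perp" "w \<in> orbit_tangent br X" for w
  proof -
    have "ip br (\<sigma> w) X = 0"
      using T.perp_ip(1)[OF T.perp_\<sigma>[OF that(1)]] ip_sym[of "\<sigma> w" E]
      by (simp add: X_eq ip.scaleR_right)
    then show ?thesis using J_formula[OF X that(2)] by (simp add: X_eq br.scaleR_left)
  qed
  have "- v = J X (J X v)" by (simp add: J_J[OF X vt])
  also have "\<dots> = J X (br E ((- (m X * t)) *\<^sub>R \<sigma> v))"
    by (simp add: J_perp[OF vp vt] br.scaleR_right br.minus_right)
  also have "\<dots> = - (m X * t) *\<^sub>R br E (\<sigma> (br E ((- (m X * t)) *\<^sub>R \<sigma> v)))"
  proof (rule J_perp[OF T.perp_br_E tangent])
    show "(- (m X * t)) *\<^sub>R \<sigma> v \<in> T.perp"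
      using T.perp_\<sigma>[OF vp] by (simp add: T.perp_def ip.scaleR_right ip.minus_right)
  qed
  also have "\<dots> = - ((m X * t)\<^sup>2) *\<^sub>R br E (br T.F v)"
    by (simp add: \<sigma>_br T.\<sigma>_E linear_scale[OF linear_\<sigma>] linear_neg[OF linear_\<sigma>] br.scaleR_right
        br.minus_left br.minus_right power2_eq_square)
  also have "br E (br T.F v) = v" unfolding v_def by (rule T.perp_weight[OF a])
  finally have "((m X * t)\<^sup>2 - 1) *\<^sub>R v = 0" by (simp add: algebra_simps)
  then have mt2: "(m X * t)\<^sup>2 = 1" using v0 by simp
  \<comment> \<open>Orthogonality reduces \<open>g X v v\<close> to
    \<open>m X * eta br \<sigma> v\<close>, whose positivity selects the root of
    \<open>mt2\<close>.\<close>
  have "ip br v (\<sigma> X) = 0"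
    using T.perp_ip(3)[OF vp] ip_sym[of v] by (simp add: \<sigma>X ip.scaleR_right ip.minus_right)
  then have "g X v v = m X * eta br \<sigma> v"
    using metric_potential(1)[OF X vt vt] by (simp add: ip_eta)
  then have "m X > 0"
    using g_pos[OF X vt v0] eta_pos[OF v0] by (simp add: zero_less_mult_iff)
  then have "m X * t = 1" using mt2 t by (simp add: power2_eq_1_iff) (smt (verit) mult_pos_pos)
  then show m: "m X = 1 / t" using t by (simp add: field_simps)
  \<comment> \<open>The coefficient of \<open>H\<close> in \<open>J X X\<close>, to which both terms
    of the formula contribute.\<close>
  define c where "c = m X * t\<^sup>2 + q X * t ^ 4 * L"
  have "br X (\<sigma> X) = - (t\<^sup>2) *\<^sub>R T.H"
    unfolding \<sigma>X unfolding X_eq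
    by (simp add: br.scaleR_left br.scaleR_right br.minus_right T.br_EF power2_eq_square)
  moreover have "ip br (\<sigma> X) X = complex_of_real (t\<^sup>2 * L)"
    unfolding \<sigma>X unfolding X_eq
    by (simp add: ip.scaleR_left ip.scaleR_right ip.minus_left T.ip_FE power2_eq_square
        scaleR_conv_of_real[where 'a = complex])
  ultimately have "J X X = c *\<^sub>R T.H"
    unfolding J_formula[OF X radial_tangent[OF X]]
    by (simp add: scaleR_eq_of_real c_def vec_eq_iff power2_eq_square power4_eq_xxxx algebra_simps)
  \<comment> \<open>Written as a bracket with \<open>E\<close>, the vector is visibly tangent, and
    the formula for \<open>J\<close> can be applied a second time.\<close>
  also have "\<dots> = br E (c *\<^sub>R T.F)" by (simp add: br.scaleR_right T.br_EF)
  finally have "- X = J X (br E (c *\<^sub>R T.F))" using J_J[OF X radial_tangent[OF X]] by simp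
  also have "\<dots> = - (2 * c * m X) *\<^sub>R X"
    unfolding J_formula[OF X tangent]
    by (simp add: X_eq br.scaleR_left br.scaleR_right br.minus_right T.br_EF linear_scale[OF linear_\<sigma>]
       T.\<sigma>_H ip.scaleR_right ip.scaleR_left ip.minus_left T.triple_ip T.br_EH)
      (simp add: scaleR_eq_of_real vec_eq_iff)
  finally have "(2 * c * m X - 1) *\<^sub>R X = 0" by (simp add: algebra_simps)
  then have "2 * c * m X = 1" using nonzero[OF X] by simp
  then have "2 * (t + q X * t ^ 4 * L) = t"
    using t by (simp add: m c_def power2_eq_square field_simps)
  then have "t * (2 * q X * t ^ 3 * L + 1) = 0" by (simp add: power4_eq_xxxx power3_eq_cube algebra_simps)
  then have "2 * q X * t ^ 3 * L + 1 = 0" using t by simp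
  then show "q X = - 1 / (2 * t ^ 3 * L)" using t L_pos by (simp add: field_simps)
qed

lemma J_explicit:
  assumes X: "X \<in> M" and simple: "simple_lie_algebra br" and not_sl2: "\<not> isomorphic_sl2 br"
    and lam: "lam > 0" "lam\<^sup>2 = L" and v: "v \<in> orbit_tangent br X"
  shows "J X v = - (lam / (2 * eta br \<sigma> X powr (3 / 2))) *\<^sub>R
     ((2 * eta br \<sigma> X) *\<^sub>R br X (\<sigma> v) - ip br (\<sigma> v) X *s br X (\<sigma> X))"
proof -
  obtain t E where t: "t > 0" and X_eq: "X = t *\<^sub>R E" and eta: "eta br \<sigma> X = t\<^sup>2 * L"
    and tr: "minimal_triple br \<sigma> L E" by (rule triple[OF X])
  note mq = coefficients[OF X X_eq t tr simple not_sl2]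
  \<comment> \<open>A perfect square, so the power \<open>3 / 2\<close> is the cube of
    \<open>t * lam\<close>; the prefactor becomes \<open>- q X\<close>.\<close>
  have "eta br \<sigma> X = (t * lam) powr 2"
    using t lam by (simp add: eta power_mult_distrib)
  then have "eta br \<sigma> X powr (3/2) = (t * lam) powr 3" by (simp add: powr_powr)
  also have "\<dots> = t ^ 3 * lam ^ 3" using t lam by (simp add: power_mult_distrib)
  finally have "lam / (2 * eta br \<sigma> X powr (3 / 2)) = 1 / (2 * t ^ 3 * L)"
    using lam t by (simp add: lam(2)[symmetric] power3_eq_cube power2_eq_square)
  moreover have "1 / (2 * t ^ 3 * L) * (2 * eta br \<sigma> X) = 1 / t"
    using t L_pos by (simp add: eta power3_eq_cube power2_eq_square)
  ultimately show ?thesis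
    unfolding J_formula[OF X v] mq
    by (simp add: scaleR_diff_right scaleR_eq_of_real[where x = "_ *s _"])
qed

end

theorem mainTheorem3:
  fixes br :: "('n::finite) bracket"
    and \<sigma> :: "complex ^ 'n \<Rightarrow> complex ^ 'n"
    and h :: "(complex ^ 'n) set"
    and P :: "(complex ^ 'n \<Rightarrow> complex) set"
    and E H F :: "(complex ^ 'n \<Rightarrow> complex) \<Rightarrow> complex ^ 'n"
    and \<alpha> :: "complex ^ 'n \<Rightarrow> complex"
    and M :: "(complex ^ 'n) set"
    and g :: "complex ^ 'n \<Rightarrow> complex ^ 'n \<Rightarrow> complex ^ 'n \<Rightarrow> real"
    and J K :: "complex ^ 'n \<Rightarrow> complex ^ 'n \<Rightarrow> complex ^ 'n"
    and \<rho> :: "complex ^ 'n \<Rightarrow> real"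
    and lam :: real
    and X A :: "complex ^ 'n"
  assumes "simple_lie_algebra br"
    and "\<not> isomorphic_sl2 br"
    and "compact_real_structure br \<sigma>"
    and "cartan_subalgebra br h"
    and "positive_system br h P"
    and "cartan_basis br h P E H F"
    and "sigma_compatible \<sigma> P E H F"
    and "highest_root br P E \<alpha>"
    and "M = adjoint_orbit br (E \<alpha>)"
    and "hyperkahler M (orbit_tangent br) g orbit_I J K"
    and "kahler_potential M (orbit_tangent br) g orbit_I \<rho>"
    and "G_invariant br \<sigma> M \<rho>"
    and "kks_compatible br M g J K"
    and "lam > 0"
    and "lam\<^sup>2 = eta br \<sigma> (E \<alpha>)"
    and "X \<in> M"
  shows "J X (br A X) =
     - (lam / (2 * eta br \<sigma> X powr (3 / 2))) *\<^sub>R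
       ((2 * eta br \<sigma> X) *\<^sub>R br X (\<sigma> (br A X))
        - ip br (\<sigma> (br A X)) X *s br X (\<sigma> X))"
proof -
  interpret cartan_data br \<sigma> h P E H F
    using assms by unfold_locales (simp_all add: simple_lie_algebra_def)
  define L where "L = eta br \<sigma> (E \<alpha>)"
  have E0: "E \<alpha> \<noteq> 0"
    using E_nonzero assms(8) by (simp add: highest_root_def)
  have minimal: "minimal_vector (2 / complex_of_real L) (E \<alpha>)"
    unfolding L_def by (rule highest_root_minimal[OF assms(8)])
  \<comment> \<open>Nonvanishing and minimality spread from \<open>E \<alpha>\<close> over the
    orbit, so the locale covers every point of \<open>M\<close>.\<close>
  interpret orbit_hyperkahler br \<sigma> M L g \<rho> J K
  proof
    show "L > 0" unfolding L_def by (rule eta_pos[OF E0])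
    show "exp_ad br A X \<in> M" if "X \<in> M" for A X
      using that adjoint_orbit_exp_ad assms(9) by blast
    show "X \<noteq> 0" "minimal_vector (2 / complex_of_real L) X" if "X \<in> M" for X
      using adjoint_orbit_minimal[OF _ minimal E0] that assms(9) by auto
  qed (fact assms)+
  show ?thesis
    using assms by (intro J_explicit) (auto simp: orbit_tangent_def L_def)
qed

end
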